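(* Let $k$ be a field of characteristic two, and let $f\in k[X]$ be a monic polynomial of degree $n\geq 1$. Then $f$ is the characteristic polynomial of a symmetric matrix of $\mathrm{M}_n(k)$ if and only if it is not the product of pairwise distinct monic irreducible inseparable polynomials of $k[X]$. In particular, if $k$ is perfect, any monic polynomial $f\in k[X]$ of degree $n\geq 1$ is the characteristic polynomial of a symmetric matrix of $\mathrm{M}_n(k)$.
   Context: $\mathrm{M}_n(k)$ denotes the ring of $n\times n$ matrices with entries in $k$. An irreducible polynomial of $k[X]$ is separable if it has no multiple root in an algebraic closure of $k$, and inseparable otherwise. A product of pairwise distinct polynomials may consist of a single factor. *)

theory Defs
  imports
    "HOL-Algebra.Algebraic_Closure_Type"
    "Jordan_Normal_Form.Char_Poly"
begin

text \<open>
  A multiple root is one of order at least 2; the type \<^typ>\<open>'a alg_closure\<close> is an algebraic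
  closure of \<^typ>\<open>'a\<close>, with embedding \<^const>\<open>to_ac\<close>. Since \<^term>\<open>Polynomial.order x 0\<close> is
  unspecified, the notion is meaningful for nonzero polynomials only.
\<close>

definition separable_poly :: "'a :: field poly \<Rightarrow> bool" where
  "separable_poly p \<longleftrightarrow>
     \<not> (\<exists>x :: 'a alg_closure. Polynomial.order x (map_poly to_ac p) \<ge> 2)"

definition inseparable_poly :: "'a :: field poly \<Rightarrow> bool" where
  "inseparable_poly p \<longleftrightarrow> \<not> separable_poly p"

definition perfect_field :: "'a :: field itself \<Rightarrow> bool" where
  "perfect_field _ \<longleftrightarrow> CHAR('a) = 0 \<or> surj (\<lambda>x :: 'a. x ^ CHAR('a))"

definition symmetric_mat :: "'a mat \<Rightarrow> bool" where
  "symmetric_mat A \<longleftrightarrow> transpose_mat A = A"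

end

theory Submission
  imports Defs
begin

text \<open>
  Necessity. Let \<open>A\<close> be symmetric with characteristic polynomial \<open>f\<close>, where \<open>f\<close> is a product of
  inseparable polynomials, hence a polynomial in \<open>X\<^sup>2\<close>, and let \<open>u\<close> be the all-ones vector.
  In characteristic two \<open>x \<bullet> x = (x \<bullet> u)\<^sup>2\<close>, so for a polynomial \<open>t = \<Sum> t\<^sub>i X\<^bsup>2i\<^esup>\<close> we have
  \<open>x \<bullet> t(A)x = \<Sum> t\<^sub>i (x \<bullet> A\<^sup>iu)\<^sup>2\<close>. Let \<open>q\<close> be the minimal polynomial of \<open>u\<close> and \<open>t\<close> the remainder of \<open>f\<close>
  modulo \<open>q\<^sup>2\<close>; since \<open>f(A) = 0\<close> and \<open>q(A)u = 0\<close>, the form \<open>x \<bullet> t(A)x\<close> vanishes, and since the vectors \<open>A\<^sup>iu\<close>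
  with \<open>i < degree q\<close> are independent, \<open>t = 0\<close>. So \<open>q\<^sup>2\<close> divides \<open>f\<close>, and \<open>f\<close> is not squarefree.

  Sufficiency. In characteristic two, a nondegenerate symmetric bilinear form that is not
  alternating and takes only squares as values on the diagonal has an orthonormal basis, so it
  suffices to find an endomorphism with characteristic polynomial \<open>f\<close> that is self-adjoint for such
  a form. On \<open>k[X]/(f)\<close> with the multiplication by \<open>X\<close> take the form \<open>(g, h) \<mapsto> \<tau>(r g h)\<close>, where \<open>\<tau>\<close> is
  the coefficient of degree \<open>n - 1\<close> of the remainder modulo \<open>f\<close>. It is nondegenerate if \<open>r\<close> is prime
  to \<open>f\<close>, and if \<open>(r f)' = s\<^sup>2\<close> then \<open>\<tau>(r g\<^sup>2) = \<tau>(s g)\<^sup>2\<close>. Such \<open>r\<close> are \<open>p'\<close> for a separable irreducible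
  \<open>f = p\<close> (then \<open>s = p'\<close>; this is the trace form), \<open>1\<close> for an inseparable irreducible \<open>f = p\<close> (then \<open>s = 0\<close> and the
  form is alternating), and \<open>X\<close> for \<open>f = p\<^sup>2\<close> with \<open>p\<close> inseparable (then \<open>s = p\<close>). Orthogonal sums of these give
  every \<open>f\<close> with a separable or a repeated irreducible factor.
\<close>

section \<open>Polynomials in a matrix\<close>

text \<open>Horner evaluation of \<open>g\<close> at \<open>A\<close>. The starting value takes its
  size from \<open>A\<close>, so that the zero polynomial gives a square zero matrix of the right
  dimension.\<close>

definition mat_poly :: "'a :: comm_ring_1 mat \<Rightarrow> 'a poly \<Rightarrow> 'a mat" where
  "mat_poly A g = fold_coeffs (\<lambda>a M. a \<cdot>\<^sub>m 1\<^sub>m (dim_row A) + A * M) g (0\<^sub>m (dim_row A) (dim_row A))"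

context
  fixes A :: "'a :: comm_ring_1 mat" and n :: nat
  assumes A [simp]: "A \<in> carrier_mat n n"
begin

private lemma base_dim [simp]: "dim_row A = n" "dim_col A = n"
  using A by (metis carrier_matD)+

lemma mat_poly_0 [simp]: "mat_poly A 0 = 0\<^sub>m n n"
  using A by (auto simp: mat_poly_def)

lemma mat_poly_pCons: "mat_poly A (pCons a g) = a \<cdot>\<^sub>m 1\<^sub>m n + A * mat_poly A g"
proof (cases "a = 0 \<and> g = 0")
  case True
  have "0 \<cdot>\<^sub>m 1\<^sub>m n + A * 0\<^sub>m n n = (0\<^sub>m n n :: 'a mat)"
    by (auto simp: scalar_prod_def)
  then show ?thesis using True by simp
next
  case False
  then show ?thesis using A by (auto simp: mat_poly_def)
qed

lemma mat_poly_carrier [simp]: "mat_poly A g \<in> carrier_mat n n"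
  by (induction g) (use A in \<open>auto simp: mat_poly_pCons\<close>)

lemma mat_poly_dim [simp]: "dim_row (mat_poly A g) = n" "dim_col (mat_poly A g) = n"
  using mat_poly_carrier by (metis carrier_matD)+

lemma mat_poly_1 [simp]: "mat_poly A 1 = 1\<^sub>m n"
proof -
  have "mat_poly A 1 = 1 \<cdot>\<^sub>m 1\<^sub>m n + A * 0\<^sub>m n n"
    by (simp add: one_pCons mat_poly_pCons)
  also have "\<dots> = 1\<^sub>m n" by (auto simp: scalar_prod_def)
  finally show ?thesis .
qed

lemma mat_poly_pCons_0: "mat_poly A (pCons 0 g) = A * mat_poly A g"
  by (auto simp: mat_poly_pCons scalar_prod_def)

lemma mat_poly_const: "mat_poly A [:a:] = a \<cdot>\<^sub>m 1\<^sub>m n"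
  by (auto simp: mat_poly_pCons scalar_prod_def)

lemma mat_poly_add: "mat_poly A (g + h) = mat_poly A g + mat_poly A h"
proof (induction g h rule: poly_induct2)
  case 0
  show ?case by simp
next
  case (pCons a g b h)
  have "mat_poly A (pCons a g + pCons b h) =
      (a + b) \<cdot>\<^sub>m 1\<^sub>m n + (A * mat_poly A g + A * mat_poly A h)"
    by (simp add: mat_poly_pCons pCons mult_add_distrib_mat[of _ n n _ n])
  also have "\<dots> = mat_poly A (pCons a g) + mat_poly A (pCons b h)"
    using A by (auto simp: mat_poly_pCons algebra_simps )
  finally show ?case .
qed

lemma mat_poly_smult: "mat_poly A (Polynomial.smult c g) = c \<cdot>\<^sub>m mat_poly A g"
proof (induction g)
  case 0
  show ?case by auto
next
  case (pCons a g)
  have "mat_poly A (Polynomial.smult c (pCons a g)) = (c * a) \<cdot>\<^sub>m 1\<^sub>m n + c \<cdot>\<^sub>m (A * mat_poly A g)"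
    by (simp add: mat_poly_pCons pCons mult_smult_distrib[of _ n n _ n])
  also have "\<dots> = c \<cdot>\<^sub>m mat_poly A (pCons a g)"
    using A by (auto simp: mat_poly_pCons algebra_simps )
  finally show ?case .
qed

lemma mat_poly_mult: "mat_poly A (g * h) = mat_poly A g * mat_poly A h"
proof (induction g)
  case 0
  show ?case by (auto simp: left_mult_zero_mat[of _ n n])
next
  case (pCons a g)
  have "mat_poly A (pCons a g * h) = a \<cdot>\<^sub>m mat_poly A h + A * (mat_poly A g * mat_poly A h)"
    by (simp add: mat_poly_add mat_poly_smult mat_poly_pCons_0 pCons)
  also have "\<dots> = a \<cdot>\<^sub>m 1\<^sub>m n * mat_poly A h + A * mat_poly A g * mat_poly A h"
    by (simp add: assoc_mult_mat[of A n n _ n _ n] mult_smult_assoc_mat[of _ n n _ n])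
  also have "\<dots> = mat_poly A (pCons a g) * mat_poly A h"
    unfolding mat_poly_pCons by (rule add_mult_distrib_mat[symmetric, of _ n n _ _ n]) auto
  finally show ?case .
qed

lemma mat_poly_X [simp]: "mat_poly A [:0, 1:] = A"
proof -
  have "mat_poly A [:0, 1:] = A * mat_poly A 1" 
    by (simp only: mat_poly_pCons_0 one_pCons)
  then show ?thesis using A by simp
qed

lemma mat_poly_transpose:
  assumes "transpose_mat A = A"
  shows "transpose_mat (mat_poly A g) = mat_poly A g"
proof (induction g)
  case 0
  show ?case by simp
next
  case (pCons a g)
  have "transpose_mat (A * mat_poly A g) = mat_poly A g * A"
    using A by (simp add: transpose_mult[of _ n n _ n] pCons assms)
  \<comment> \<open>Writing \<open>A\<close> as the value of the indeterminate turns commutation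
    with \<open>mat_poly A g\<close> into commutativity of polynomials.\<close>
  also have "\<dots> = mat_poly A g * mat_poly A [:0, 1:]" by simp
  also have "\<dots> = A * mat_poly A g"
    by (simp only: mat_poly_mult[symmetric] mult.commute[of g]) (simp only: mat_poly_mult mat_poly_X)
  finally have *: "transpose_mat (A * mat_poly A g) = A * mat_poly A g" .
  have "transpose_mat (mat_poly A (pCons a g)) =
      transpose_mat (a \<cdot>\<^sub>m 1\<^sub>m n) + transpose_mat (A * mat_poly A g)"
    unfolding mat_poly_pCons using A by (intro transpose_add[of _ n n]) auto
  also have "transpose_mat (a \<cdot>\<^sub>m 1\<^sub>m n) = a \<cdot>\<^sub>m 1\<^sub>m n"
    by (auto )
  finally show ?case by (simp add: * mat_poly_pCons)
qed

lemma mat_poly_sum_index: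
  assumes "i < n" "j < n" "finite S"
  shows "mat_poly A (sum g S) $$ (i, j) = (\<Sum>s\<in>S. mat_poly A (g s) $$ (i, j))"
  using assms(3,1,2) by (induction S) (auto simp: mat_poly_add)

text \<open>
  Regard the space of column vectors as a module over the polynomial ring, the indeterminate
  acting as \<open>A\<close>. The columns of the characteristic matrix are relations between
  the unit vectors, and multiplying by the adjugate turns them into the relation \<open>char_poly A\<close>
  for each unit vector.
\<close>

theorem Cayley_Hamilton: "mat_poly A (char_poly A) = 0\<^sub>m n n"
proof (rule eq_matI)
  let ?M = "char_poly_matrix A"
  let ?N = "adj_mat ?M"
  let ?E = "\<lambda>g i j. mat_poly A g $$ (i, j)"
  have M: "?M \<in> carrier_mat n n" by simp
  note N = adj_mat[OF M]
  fix l k assume "l < dim_row (0\<^sub>m n n :: 'a mat)" "k < dim_col (0\<^sub>m n n :: 'a mat)"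
  then have lk: "l < n" "k < n" by auto
  have entry: "?E (?M $$ (i, j)) m i = (if i = j then A $$ (m, j) else 0) -
      (if m = i then A $$ (i, j) else 0)" if "i < n" "j < n" "m < n" for i j m
  proof -
    have "?M $$ (i, j) = (if i = j then [:0, 1:] else 0) + [:- (A $$ (i, j)):]"
      using that A by (auto simp: char_poly_matrix_def)
    then show ?thesis
      using that A by (auto simp: mat_poly_add mat_poly_const)
  qed
  \<comment> \<open>Column \<open>j\<close> of the characteristic matrix, acting on the unit
    vectors, yields column \<open>j\<close> of \<open>A\<close> minus its own expansion in unit
    vectors.\<close>
  have rel: "(\<Sum>i<n. ?E (?M $$ (i, j)) m i) = 0" if "j < n" "m < n" for j m
    using that by (simp add: entry sum_subtractf)
  have MN: "(\<Sum>j<n. ?M $$ (i, j) * ?N $$ (j, k)) = (if i = k then char_poly A else 0)"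
    if "i < n" for i
  proof -
    have "(?M * ?N) $$ (i, k) = (\<Sum>j<n. ?M $$ (i, j) * ?N $$ (j, k))"
      using that lk carrier_matD[OF M] carrier_matD[OF N(1)]
      by (auto simp: scalar_prod_def lessThan_atLeast0)
    then show ?thesis using that lk by (auto simp: N(2) char_poly_def)
  qed
  have "?E (char_poly A) l k = (\<Sum>i<n. ?E (if i = k then char_poly A else 0) l i)"
    using lk by (simp add: if_distrib[of "\<lambda>g. ?E g l _"] cong: if_cong)
  also have "\<dots> = (\<Sum>i<n. ?E (\<Sum>j<n. ?N $$ (j, k) * ?M $$ (i, j)) l i)"
    by (intro sum.cong refl) (simp add: MN[symmetric] mult.commute)
  also have "\<dots> = (\<Sum>i<n. \<Sum>j<n. \<Sum>m<n. ?E (?N $$ (j, k)) l m * ?E (?M $$ (i, j)) m i)"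
    using lk by (intro sum.cong refl)
      (auto simp: mat_poly_sum_index mat_poly_mult scalar_prod_def lessThan_atLeast0 intro!: sum.cong)
  also have "\<dots> = (\<Sum>j<n. \<Sum>m<n. \<Sum>i<n. ?E (?N $$ (j, k)) l m * ?E (?M $$ (i, j)) m i)"
    by (subst sum.swap) (intro sum.cong refl sum.swap)
  also have "\<dots> = 0"
    by (simp add: sum_distrib_left[symmetric] rel)
  finally show "?E (char_poly A) l k = 0\<^sub>m n n $$ (l, k)" using lk by simp
qed auto

end

section \<open>Polynomials in characteristic two\<close>

abbreviation even_poly :: "'a :: comm_semiring_1 poly \<Rightarrow> 'a poly" where
  "even_poly h \<equiv> pcompose h [:0, 0, 1:]"

lemma char_two: "CHAR('a :: comm_ring_1) = 2 \<Longrightarrow> (2 :: 'a) = 0"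
  using of_nat_CHAR[where ?'a = 'a] by simp

lemma char_two_add_self:
  assumes "(2 :: 'a :: comm_ring_1) = 0"
  shows "x + x = (0 :: 'a)"
  using assms by (metis mult_2 mult_zero_left)

lemma char_two_poly:
  assumes "(2 :: 'a :: comm_ring_1) = 0"
  shows "(2 :: 'a poly) = 0"
  using assms by (simp add: numeral_poly)

lemma char_two_power2_add:
  assumes "(2 :: 'a :: comm_ring_1) = 0"
  shows "(x + y :: 'a)\<^sup>2 = x\<^sup>2 + y\<^sup>2"
  by (simp add: power2_sum assms)

lemma char_two_of_nat:
  assumes "(2 :: 'a :: comm_ring_1) = 0"
  shows "of_nat m = (if even m then 0 else 1 :: 'a)"
  using assms by (induction m) (auto simp: char_two_add_self)

lemma pderiv_power2_char_two:
  fixes p :: "'a :: idom poly"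
  assumes "(2 :: 'a) = 0"
  shows "pderiv (p\<^sup>2) = 0"
  by (simp add: pderiv_mult power2_eq_square char_two_add_self[OF char_two_poly[OF assms]])

lemma coeff_pderiv_char_two:
  fixes p :: "'a :: idom poly"
  assumes "(2 :: 'a) = 0"
  shows "coeff (pderiv p) i = (if even i then coeff p (Suc i) else 0)"
  unfolding coeff_pderiv char_two_of_nat[OF assms] by simp

text \<open>In characteristic two the derivative retains exactly the odd-degree coefficients, so
  these vanish. The induction strips two coefficients at a time, which preserves parity.\<close>

lemma pderiv_eq_0_imp_even_poly:
  fixes p :: "'a :: idom poly"
  assumes "(2 :: 'a) = 0" "pderiv p = 0"
  obtains h where "p = even_poly h"
proof -
  have "\<exists>h. p = even_poly h"
    using assms(2)
  proof (induction "degree p" arbitrary: p rule: less_induct)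
    case less
    obtain a q where q: "p = pCons a q" by (cases p)
    obtain b r where r: "q = pCons b r" by (cases q)
    have "b = 0"
      using coeff_pderiv_char_two[OF assms(1), of p 0] less.prems by (simp add: q r)
    show ?case
    proof (cases "r = 0")
      case True
      then have "p = even_poly [:a:]" using \<open>b = 0\<close> by (simp add: q r)
      then show ?thesis by blast
    next
      case False
      have "coeff (pderiv r) i = 0" for i
      proof -
        have "coeff (pderiv r) i = coeff (pderiv p) (i + 2)"
          unfolding coeff_pderiv_char_two[OF assms(1)] by (simp add: q r)
        then show ?thesis by (simp add: less.prems)
      qed
      then have "pderiv r = 0" by (simp add: poly_eq_iff)
      moreover have "degree r < degree p" using False by (simp add: q r)
      ultimately obtain h where "r = even_poly h" using less.hyps by blast
      then have "p = even_poly (pCons a h)"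
        using \<open>b = 0\<close> by (simp add: q r pcompose_pCons)
      then show ?thesis by blast
    qed
  qed
  then show thesis using that by blast
qed

lemma degree_pderiv_less:
  assumes "pderiv p \<noteq> 0"
  shows "degree (pderiv p) < degree (p :: 'a :: idom poly)"
proof -
  have "degree p \<noteq> 0" using assms by (metis degree_eq_zeroE pderiv_singleton)
  moreover have "degree (pderiv p) \<le> degree p - 1" 
    by (rule degree_le) (auto simp: coeff_pderiv coeff_eq_0)
  ultimately show ?thesis by linarith
qed

section \<open>Factorization into monic irreducible polynomials\<close>

lemma dvd_1_iff_degree_eq_0: "p dvd 1 \<longleftrightarrow> p \<noteq> 0 \<and> degree p = 0" for p :: "'a :: field poly"
  by (simp add: is_unit_iff_degree)

lemma degree_irreducible_pos: "irreducible p \<Longrightarrow> degree p > 0" for p :: "'a :: field poly"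
  by (metis dvd_1_iff_degree_eq_0 gr0I irreducible_def)

lemma monic_irreducible_factor_exists:
  fixes f :: "'a :: field poly"
  assumes "degree f > 0"
  obtains p where "monic p" "irreducible p" "p dvd f"
proof -
  have "\<exists>p. monic p \<and> irreducible p \<and> p dvd f"
    using assms
  proof (induction "degree f" arbitrary: f rule: less_induct)
    case less
    show ?case
    proof (cases "irreducible f")
      case True
      have "lead_coeff f \<noteq> 0" using less.prems by auto
      define p where "p = Polynomial.smult (inverse (lead_coeff f)) f"
      have "monic p" "p dvd f" "f dvd p"
        using \<open>lead_coeff f \<noteq> 0\<close> by (auto simp: p_def smult_dvd_iff dvd_smult)
      moreover have "irreducible p"
        using True \<open>lead_coeff f \<noteq> 0\<close> by (simp add: p_def)
      ultimately show ?thesis by blast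
    next
      case False
      have "f \<noteq> 0" "\<not> f dvd 1" using less.prems by (auto simp: dvd_1_iff_degree_eq_0)
      with False obtain a b where ab: "f = a * b" "\<not> a dvd 1" "\<not> b dvd 1"
        unfolding irreducible_def by blast
      have "degree a > 0" "degree b > 0" using ab \<open>f \<noteq> 0\<close> by (auto simp: dvd_1_iff_degree_eq_0)
      then have "degree a < degree f" using ab \<open>f \<noteq> 0\<close> by (simp add: degree_mult_eq)
      from less.hyps[OF this \<open>degree a > 0\<close>] show ?thesis using ab by (auto intro: dvd_mult2)
    qed
  qed
  then show thesis using that by blast
qed

lemma monic_dvd_irreducible_eq:
  fixes p q :: "'a :: field poly"
  assumes "monic p" "irreducible p" "monic q" "irreducible q" "p dvd q"
  shows "p = q"
proof -
  obtain c where c: "q = p * c" using assms(5) by blast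
  then have "c dvd 1" using assms(2,4) unfolding irreducible_def by blast
  then obtain a where "c = [:a:]" by (metis dvd_1_iff_degree_eq_0 degree_eq_zeroE)
  moreover have "lead_coeff c = 1" using c assms(1,3) by (metis lead_coeff_mult mult_1)
  ultimately have "c = 1" by (simp add: one_pCons)
  then show ?thesis using c by simp
qed

lemma prime_elem_dvd_prodE:
  assumes "finite P" "prime_elem p" "p dvd \<Prod>P"
  obtains q where "q \<in> P" "p dvd q"
  using assms by (induction P) (auto simp: prime_elem_dvd_mult_iff prime_elem_not_unit)

text \<open>An irreducible factor \<open>p\<close> of \<open>q\<close> would divide the product
  twice. Being prime and monic it is a member of \<open>P\<close>; after cancelling it, it would
  have to equal a second, different member.\<close>

lemma irreducible_squarefree_prod:
  fixes P :: "'a :: field poly set"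
  assumes P: "finite P" "\<And>p. p \<in> P \<Longrightarrow> monic p \<and> irreducible p"
    and q: "degree q > 0"
  shows "\<not> q\<^sup>2 dvd \<Prod>P"
proof
  assume "q\<^sup>2 dvd \<Prod>P"
  obtain p where p: "monic p" "irreducible p" "p dvd q"
    using monic_irreducible_factor_exists[OF q] .
  have prime: "prime_elem p" using p by (simp add: field_poly_irreducible_imp_prime)
  have pp: "p * p dvd \<Prod>P"
    using \<open>q\<^sup>2 dvd \<Prod>P\<close> p(3) by (metis dvd_trans mult_dvd_mono power2_eq_square)
  then have "p dvd \<Prod>P" using dvd_mult_left by blast
  then obtain p' where "p' \<in> P" "p dvd p'" using prime_elem_dvd_prodE[OF P(1) prime] by metis
  then have "p \<in> P" using monic_dvd_irreducible_eq p P(2) by metis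
  then have "\<Prod>P = p * \<Prod>(P - {p})" using P(1) by (simp add: prod.remove)
  then have "p dvd \<Prod>(P - {p})" using pp p(2) by (simp add: irreducible_def)
  then obtain p'' where "p'' \<in> P - {p}" "p dvd p''"
    using prime_elem_dvd_prodE[OF finite_Diff[OF P(1)] prime] by metis
  then show False using monic_dvd_irreducible_eq[of p p''] p P(2) by auto
qed

text \<open>Irreducible factors are split off one by one; a factor met twice would have its square
  dividing \<open>f\<close>. The clause \<open>p dvd f\<close> lets hypotheses on the divisors of
  \<open>f\<close> reach the members of \<open>P\<close>.\<close>

lemma squarefree_eq_prod_irreducible:
  fixes f :: "'a :: field poly"
  assumes "monic f" "\<And>p. monic p \<Longrightarrow> irreducible p \<Longrightarrow> \<not> p\<^sup>2 dvd f"
  obtains P where "finite P" "\<And>p. p \<in> P \<Longrightarrow> monic p \<and> irreducible p \<and> p dvd f" "f = \<Prod>P"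
proof -
  have "\<exists>P. finite P \<and> (\<forall>p\<in>P. monic p \<and> irreducible p \<and> p dvd f) \<and> f = \<Prod>P"
    using assms
  proof (induction "degree f" arbitrary: f rule: less_induct)
    case less
    show ?case
    proof (cases "degree f = 0")
      case True
      then have "f = 1" using less.prems(1) by (metis degree_eq_zeroE lead_coeff_pCons(2) one_pCons)
      then show ?thesis by (intro exI[of _ "{}"]) simp
    next
      case False
      then obtain p where p: "monic p" "irreducible p" "p dvd f"
        using monic_irreducible_factor_exists by blast
      then obtain g where g: "f = p * g" by blast
      have "monic g" using g p(1) less.prems(1) by (metis lead_coeff_mult mult_1)
      have "degree p > 0" using p(2) by (rule degree_irreducible_pos)
      have "g \<noteq> 0" "p \<noteq> 0" using \<open>monic g\<close> p(1) by auto
      then have "degree g < degree f" using \<open>degree p > 0\<close> by (simp add: g degree_mult_eq)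
      moreover have "\<not> q\<^sup>2 dvd g" if "monic q" "irreducible q" for q
        using less.prems(2)[OF that] by (auto simp: g)
      ultimately have "\<exists>P. finite P \<and> (\<forall>p\<in>P. monic p \<and> irreducible p \<and> p dvd g) \<and> g = \<Prod>P"
        using \<open>monic g\<close> by (intro less.hyps) auto
      then obtain P where P: "finite P" "\<forall>p\<in>P. monic p \<and> irreducible p \<and> p dvd g" "g = \<Prod>P"
        by (elim exE conjE)
      have "p \<notin> P"
      proof
        assume "p \<in> P"
        then have "p\<^sup>2 dvd f" using P(2) by (simp add: g power2_eq_square)
        then show False using less.prems(2) p by blast
      qed
      then have "f = \<Prod>(insert p P)" using P by (simp add: g)
      moreover have "\<forall>q\<in>insert p P. monic q \<and> irreducible q \<and> q dvd f"
        using P(2) p g by auto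
      ultimately show ?thesis using P(1) by blast
    qed
  qed
  then show thesis using that by blast
qed

text \<open>A multiple root is a common root of \<open>p\<close> and \<open>pderiv p\<close>. As
  \<open>p\<close> is irreducible, it generates the ideal of polynomials vanishing there, so
  \<open>p\<close> divides its derivative, which has smaller degree unless it is zero. Conversely,
  if the derivative is zero, every root is multiple.\<close>

lemma inseparable_iff_pderiv_eq_0:
  fixes p :: "'a :: field poly"
  assumes "irreducible p"
  shows "inseparable_poly p \<longleftrightarrow> pderiv p = 0"
proof
  interpret ac: field_hom "to_ac :: 'a \<Rightarrow> 'a alg_closure"
    by unfold_locales auto
  interpret acp: map_poly_comm_ring_hom "to_ac :: 'a \<Rightarrow> 'a alg_closure" ..
  let ?P = "map_poly to_ac p"
  have deriv: "pderiv ?P = map_poly to_ac (pderiv p)"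
    by (simp add: ac.map_poly_pderiv)
  {
    assume "inseparable_poly p"
    then obtain x where x: "Polynomial.order x ?P \<ge> 2"
      unfolding inseparable_poly_def separable_poly_def by blast
    then have "[:-x, 1:]\<^sup>2 dvd ?P"
      using order_1 power_le_dvd by blast
    then obtain c where c: "?P = [:-x, 1:] * ([:-x, 1:] * c)"
      unfolding power2_eq_square by (metis dvd_def mult.assoc)
    have roots: "poly ?P x = 0" "poly (map_poly to_ac (pderiv p)) x = 0"
      unfolding deriv[symmetric] unfolding c pderiv_mult by simp_all
    \<comment> \<open>The ideal of polynomials over the base field that vanish at \<open>x\<close>;
      an element \<open>m\<close> of least degree generates it and is associated to
      \<open>p\<close>.\<close>
    define I where "I = {g :: 'a poly. poly (map_poly to_ac g) x = 0}"
    have I_mod: "g mod m \<in> I" if "g \<in> I" "m \<in> I" for g m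
    proof -
      have "map_poly to_ac (g mod m) = map_poly to_ac g - map_poly to_ac (g div m) * map_poly to_ac m"
        by (metis acp.hom_mult acp.hom_minus minus_div_mult_eq_mod)
      then show ?thesis using that by (simp add: I_def)
    qed
    have "p \<in> I" "p \<noteq> 0" using roots assms by (auto simp: I_def)
    then obtain m where m: "m \<in> I" "m \<noteq> 0" and least: "\<And>g. g \<in> I \<Longrightarrow> g \<noteq> 0 \<Longrightarrow> degree m \<le> degree g"
      using ex_has_least_nat[of "\<lambda>g. g \<in> I \<and> g \<noteq> 0" p degree] by blast
    have dvd: "m dvd g" if "g \<in> I" for g
      using I_mod[OF that m(1)] least[of "g mod m"] degree_mod_less'[OF m(2), of g]
      by (metis dvd_eq_mod_eq_0 leD)
    have "\<not> m dvd 1"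
    proof
      assume "m dvd 1"
      then obtain a where "m = [:a:]" by (metis dvd_1_iff_degree_eq_0 degree_eq_zeroE)
      then show False using m by (simp add: I_def map_poly_pCons)
    qed
    moreover obtain c where c: "p = m * c" using dvd \<open>p \<in> I\<close> by blast
    ultimately have "c dvd 1" using assms unfolding irreducible_def by blast
    then have "p dvd m" using c by (metis dvd_refl mult_dvd_mono mult_unit_dvd_iff)
    then have "p dvd pderiv p" using dvd[of "pderiv p"] roots by (auto simp: I_def)
    then show "pderiv p = 0"
      using degree_pderiv_less[of p] dvd_imp_degree_le by (metis leD)
  }
  assume "pderiv p = 0"
  have "degree ?P > 0" using degree_irreducible_pos[OF assms] by simp
  then obtain x where "poly ?P x = 0" using alg_closed_imp_poly_has_root by blast
  then obtain Q where Q: "?P = [:-x, 1:] * Q" by (metis dvd_def poly_eq_0_iff_dvd)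
  have "poly (pderiv ?P) x = 0" unfolding deriv by (simp add: \<open>pderiv p = 0\<close>)
  \<comment> \<open>The derivative of \<open>[:-x, 1:] * Q\<close> takes the value
    \<open>poly Q x\<close> at \<open>x\<close>.\<close>
  then have "poly Q x = 0"
    unfolding Q pderiv_mult by (simp add: pderiv_pCons)
  then have "[:-x, 1:]\<^sup>2 dvd ?P"
    unfolding Q power2_eq_square poly_eq_0_iff_dvd by (rule mult_dvd_mono[OF dvd_refl])
  moreover have "?P \<noteq> 0" using \<open>degree ?P > 0\<close> by auto
  ultimately have "Polynomial.order x ?P \<ge> 2" by (simp add: order_divides)
  then show "inseparable_poly p" unfolding inseparable_poly_def separable_poly_def by blast
qed

text \<open>Squaring is additive, so \<open>g\<close> is obtained from \<open>h\<close> by taking a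
  square root of each coefficient.\<close>

lemma even_poly_eq_square:
  fixes h :: "'a :: field poly"
  assumes two: "(2 :: 'a) = 0" and surj: "surj (\<lambda>x :: 'a. x\<^sup>2)"
  obtains g where "even_poly h = g\<^sup>2"
proof -
  have "\<exists>g. even_poly h = g\<^sup>2"
  proof (induction h)
    case 0
    show ?case by (intro exI[of _ 0]) simp
  next
    case (pCons a h)
    obtain g where "even_poly h = g\<^sup>2" using pCons by blast
    moreover obtain c where "a = c\<^sup>2" using surj by (metis surjD)
    ultimately have "even_poly (pCons a h) = [:c:]\<^sup>2 + (pCons 0 g)\<^sup>2"
      by (simp add: pcompose_pCons power2_eq_square)
    then show ?case using char_two_power2_add[OF char_two_poly[OF two]] by metis
  qed
  then show thesis using that by blast
qed

section \<open>Symmetric matrices whose characteristic polynomial has derivative zero\<close>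

lemma zero_mat_mult_vec: "x \<in> carrier_vec m \<Longrightarrow> 0\<^sub>m n m *\<^sub>v x = (0\<^sub>v n :: 'a :: semiring_0 vec)"
  by (intro eq_vecI) (auto simp: scalar_prod_def)

lemma smult_mat_mult_vec:
  assumes "A \<in> carrier_mat n m" "x \<in> carrier_vec m"
  shows "(c \<cdot>\<^sub>m A) *\<^sub>v x = c \<cdot>\<^sub>v (A *\<^sub>v x :: 'a :: comm_semiring_0 vec)"
  using assms by (intro eq_vecI) (auto simp: scalar_prod_def sum_distrib_left mult.assoc)

lemma mat_poly_mult_vec:
  assumes "A \<in> carrier_mat n n" "x \<in> carrier_vec n"
  shows "mat_poly A (g * h) *\<^sub>v x = mat_poly A g *\<^sub>v (mat_poly A h *\<^sub>v x)"
  using assms by (simp add: mat_poly_mult[OF assms(1)] assoc_mult_mat_vec[of _ n n _ n])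

lemma mat_poly_pCons_vec:
  assumes "A \<in> carrier_mat n n" "x \<in> carrier_vec n"
  shows "mat_poly A (pCons a g) *\<^sub>v x = a \<cdot>\<^sub>v x + mat_poly A g *\<^sub>v (A *\<^sub>v x)"
proof -
  have "pCons a g = [:a:] + g * [:0, 1:]" by simp
  then have "mat_poly A (pCons a g) *\<^sub>v x = mat_poly A [:a:] *\<^sub>v x + mat_poly A (g * [:0, 1:]) *\<^sub>v x"
    using assms by (metis add_mult_distrib_mat_vec mat_poly_add mat_poly_carrier)
  also have "mat_poly A (g * [:0, 1:]) *\<^sub>v x = mat_poly A g *\<^sub>v (A *\<^sub>v x)"
    using assms by (simp only: mat_poly_mult_vec[OF assms] mat_poly_X[OF assms(1)])
  also have "mat_poly A [:a:] *\<^sub>v x = a \<cdot>\<^sub>v x"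
    using assms by (simp add: mat_poly_const smult_mat_mult_vec[of _ n n])
  finally show ?thesis .
qed

context
  fixes A :: "'a :: field mat" and n :: nat and u :: "'a vec"
  assumes A: "A \<in> carrier_mat n n" and sym: "transpose_mat A = A"
    and two: "(2 :: 'a) = 0"
  defines "u \<equiv> vec n (\<lambda>_. 1)"
begin

private lemma u_carrier: "u \<in> carrier_vec n"
  by (simp add: u_def)

private lemma mult_vec_carrier: "mat_poly A g *\<^sub>v x \<in> carrier_vec n" "A *\<^sub>v x \<in> carrier_vec n"
  using A mat_poly_carrier[OF A, of g] by (metis carrier_matD(1) dim_mult_mat_vec carrier_vec_dim_vec)+

private lemmas carr = u_carrier mult_vec_carrier A mat_poly_carrier[OF A]

lemma char_two_scalar_prod_self:
  assumes "x \<in> carrier_vec n"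
  shows "x \<bullet> x = (x \<bullet> u)\<^sup>2"
proof -
  have "(\<Sum>i\<in>S. x $ i)\<^sup>2 = (\<Sum>i\<in>S. x $ i * x $ i)" if "finite S" for S
    using that by (induction S) (simp_all add: char_two_power2_add[OF two], simp add: power2_eq_square)
  then show ?thesis using assms by (simp add: scalar_prod_def u_def)
qed

lemma mat_poly_self_adjoint:
  assumes "x \<in> carrier_vec n" "y \<in> carrier_vec n"
  shows "x \<bullet> (mat_poly A g *\<^sub>v y) = (mat_poly A g *\<^sub>v x) \<bullet> y"
  using transpose_vec_mult_scalar[OF mat_poly_carrier[OF A] assms(2,1), of g] assms carr
  by (simp add: mat_poly_transpose[OF A sym])

private lemma self_adjoint:
  assumes "x \<in> carrier_vec n" "y \<in> carrier_vec n"
  shows "x \<bullet> (A *\<^sub>v y) = (A *\<^sub>v x) \<bullet> y"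
  using mat_poly_self_adjoint[OF assms, of "[:0, 1:]"] by (simp only: mat_poly_X[OF A])

text \<open>One of the two factors \<open>A\<close> coming from the square of the indeterminate is
  moved to the other side of the scalar product. This is the recursion behind the expansion of the
  form into squares.\<close>

lemma even_poly_pCons_form:
  assumes x: "x \<in> carrier_vec n"
  shows "x \<bullet> (mat_poly A (even_poly (pCons a h)) *\<^sub>v x) =
    a * (x \<bullet> u)\<^sup>2 + (A *\<^sub>v x) \<bullet> (mat_poly A (even_poly h) *\<^sub>v (A *\<^sub>v x))"
proof -
  let ?e = "even_poly h"
  have "even_poly (pCons a h) = pCons a (?e * [:0, 1:])"
    by (simp add: pcompose_pCons)
  also have "mat_poly A \<dots> *\<^sub>v x = a \<cdot>\<^sub>v x + mat_poly A ([:0, 1:] * ?e) *\<^sub>v (A *\<^sub>v x)"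
    unfolding mat_poly_pCons_vec[OF A x] by (simp only: mult.commute)
  also have "mat_poly A ([:0, 1:] * ?e) *\<^sub>v (A *\<^sub>v x) = A *\<^sub>v (mat_poly A ?e *\<^sub>v (A *\<^sub>v x))"
    using carr by (simp only: mat_poly_mult_vec mat_poly_X)
  finally show ?thesis
    using x carr by (simp add: scalar_prod_add_distrib[of _ n] self_adjoint char_two_scalar_prod_self)
qed

text \<open>Orthogonality to all \<open>mat_poly A r *\<^sub>v u\<close> passes from
  \<open>x\<close> to \<open>A *\<^sub>v x\<close>, so every square in the expansion is
  zero.\<close>

lemma even_poly_form_eq_0:
  assumes "x \<in> carrier_vec n" "\<And>r. x \<bullet> (mat_poly A r *\<^sub>v u) = 0"
  shows "x \<bullet> (mat_poly A (even_poly h) *\<^sub>v x) = 0"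
  using assms
proof (induction h arbitrary: x)
  case 0
  then show ?case using A by (simp add: zero_mat_mult_vec)
next
  case (pCons a h)
  have "x \<bullet> u = 0" using pCons.prems(2)[of 1] A carr by simp
  moreover have "(A *\<^sub>v x) \<bullet> (mat_poly A r *\<^sub>v u) = 0" for r
  proof -
    have "(A *\<^sub>v x) \<bullet> (mat_poly A r *\<^sub>v u) = x \<bullet> (A *\<^sub>v (mat_poly A r *\<^sub>v u))"
      using pCons.prems(1) carr by (simp add: self_adjoint)
    also have "A *\<^sub>v (mat_poly A r *\<^sub>v u) = mat_poly A ([:0, 1:] * r) *\<^sub>v u"
      using carr by (simp only: mat_poly_mult_vec mat_poly_X)
    finally show ?thesis by (simp add: pCons.prems(2))
  qed
  ultimately show ?case
    using pCons.prems(1) carr by (simp only: even_poly_pCons_form pCons.IH) simp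
qed

text \<open>Replacing \<open>x\<close> by \<open>A *\<^sub>v x\<close> lowers the index of the
  Krylov vectors by one, in step with the degree of \<open>h\<close>. Of the squares in the
  expansion only the last survives.\<close>

lemma even_poly_form_lead:
  assumes "x \<in> carrier_vec n" "\<And>j. j < degree h \<Longrightarrow> x \<bullet> (mat_poly A (monom 1 j) *\<^sub>v u) = 0"
  shows "x \<bullet> (mat_poly A (even_poly h) *\<^sub>v x) =
    lead_coeff h * (x \<bullet> (mat_poly A (monom 1 (degree h)) *\<^sub>v u))\<^sup>2"
  using assms
proof (induction h arbitrary: x)
  case 0
  then show ?case using A by (simp add: zero_mat_mult_vec)
next
  case (pCons a h)
  have shift: "(A *\<^sub>v x) \<bullet> (mat_poly A (monom 1 j) *\<^sub>v u) = x \<bullet> (mat_poly A (monom 1 (Suc j)) *\<^sub>v u)" for j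
  proof -
    have "(A *\<^sub>v x) \<bullet> (mat_poly A (monom 1 j) *\<^sub>v u) = x \<bullet> (A *\<^sub>v (mat_poly A (monom 1 j) *\<^sub>v u))"
      using pCons.prems(1) carr by (simp add: self_adjoint)
    also have "A *\<^sub>v (mat_poly A (monom 1 j) *\<^sub>v u) = mat_poly A ([:0, 1:] * monom 1 j) *\<^sub>v u"
      using carr by (simp only: mat_poly_mult_vec mat_poly_X)
    finally show ?thesis by (simp add: monom_Suc)
  qed
  show ?case
  proof (cases "h = 0")
    case True
    then show ?thesis
      using pCons.prems(1) carr A
      by (simp add: mat_poly_const smult_mat_mult_vec[of _ n n] char_two_scalar_prod_self monom_0 flip: one_pCons)
  next
    case False
    have "x \<bullet> u = 0" using pCons.prems(2)[of 0] A carr False by (simp add: monom_0 flip: one_pCons)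
    moreover have "(A *\<^sub>v x) \<bullet> (mat_poly A (monom 1 j) *\<^sub>v u) = 0" if "j < degree h" for j
      using that False pCons.prems(2)[of "Suc j"] by (simp add: shift)
    ultimately show ?thesis
      using pCons.prems(1) carr False
      by (simp only: even_poly_pCons_form pCons.IH shift) simp
  qed
qed

text \<open>The double annihilator of the span of the first \<open>i\<close> Krylov vectors is that
  span. The bound on \<open>r\<close> is put on coefficients because for \<open>i = 0\<close> it
  must force \<open>r = 0\<close>, which a degree bound does not express.\<close>

lemma Krylov_span:
  assumes "w \<in> carrier_vec n"
    and "\<And>x. x \<in> carrier_vec n \<Longrightarrow> (\<And>j. j < i \<Longrightarrow> x \<bullet> (mat_poly A (monom 1 j) *\<^sub>v u) = 0) \<Longrightarrow> x \<bullet> w = 0"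
  shows "\<exists>r. (\<forall>j\<ge>i. coeff r j = 0) \<and> w = mat_poly A r *\<^sub>v u"
  using assms
proof (induction i arbitrary: w)
  case 0
  have "w $ k = 0" if "k < n" for k
    using 0(2)[of "unit_vec n k"] 0(1) that by simp
  then have "w = 0\<^sub>v n" using 0(1) by (auto intro!: eq_vecI)
  then show ?case using A carr by (intro exI[of _ 0]) (auto simp: zero_mat_mult_vec)
next
  case (Suc i)
  let ?v = "\<lambda>j. mat_poly A (monom 1 j) *\<^sub>v u"
  show ?case
  proof (cases "\<forall>x\<in>carrier_vec n. (\<forall>j<i. x \<bullet> ?v j = 0) \<longrightarrow> x \<bullet> w = 0")
    case True
    then have "\<exists>r. (\<forall>j\<ge>i. coeff r j = 0) \<and> w = mat_poly A r *\<^sub>v u"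
      using Suc.prems(1) by (intro Suc.IH) auto
    then obtain r where r: "\<forall>j\<ge>i. coeff r j = 0" "w = mat_poly A r *\<^sub>v u" by blast
    then have "\<forall>j\<ge>Suc i. coeff r j = 0" by simp
    then show ?thesis using r(2) by (intro exI[of _ r] conjI)
  next
    case False
    then obtain y where y: "y \<in> carrier_vec n" "\<And>j. j < i \<Longrightarrow> y \<bullet> ?v j = 0" "y \<bullet> w \<noteq> 0" by blast
    have yi: "y \<bullet> ?v i \<noteq> 0"
    proof
      assume "y \<bullet> ?v i = 0"
      then have "y \<bullet> w = 0" using y by (intro Suc.prems(2)) (auto simp: less_Suc_eq)
      then show False using y(3) by blast
    qed
    \<comment> \<open>Chosen so that \<open>w - c \<cdot>\<^sub>v ?v i\<close> is orthogonal to
      \<open>y\<close>.\<close>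
    define c where "c = (y \<bullet> w) / (y \<bullet> ?v i)"
    define w' where "w' = w - c \<cdot>\<^sub>v ?v i"
    have w': "w' \<in> carrier_vec n" using Suc.prems(1) carr by (simp add: w'_def)
    have "x \<bullet> w' = 0" if x: "x \<in> carrier_vec n" "\<And>j. j < i \<Longrightarrow> x \<bullet> ?v j = 0" for x
    proof -
      \<comment> \<open>Subtracting this multiple of \<open>y\<close> makes \<open>x\<close>
        orthogonal to \<open>?v i\<close> as well, while keeping it orthogonal to the earlier
        vectors.\<close>
      define b where "b = (x \<bullet> ?v i) / (y \<bullet> ?v i)"
      have "(x - b \<cdot>\<^sub>v y) \<bullet> w = 0"
      proof (rule Suc.prems(2))
        show "x - b \<cdot>\<^sub>v y \<in> carrier_vec n" using x y by simp
        show "(x - b \<cdot>\<^sub>v y) \<bullet> ?v j = 0" if "j < Suc i" for j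
          using x y yi that carr by (auto simp: less_Suc_eq minus_scalar_prod_distrib[of _ n] b_def)
      qed
      then have "x \<bullet> w = b * (y \<bullet> w)"
        using x y Suc.prems(1) by (simp add: minus_scalar_prod_distrib[of _ n])
      then show ?thesis
        using x Suc.prems(1) carr by (simp add: w'_def scalar_prod_minus_distrib[of _ n] b_def c_def)
    qed
    then obtain r where r: "\<forall>j\<ge>i. coeff r j = 0" "w' = mat_poly A r *\<^sub>v u"
      using Suc.IH[OF w'] by blast
    have "w = w' + c \<cdot>\<^sub>v ?v i" using Suc.prems(1) carr by (auto simp: w'_def)
    also have "c \<cdot>\<^sub>v ?v i = mat_poly A (Polynomial.smult c (monom 1 i)) *\<^sub>v u"
      using carr A by (simp only: mat_poly_smult smult_mat_mult_vec[of _ n n])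
    also have "w' + \<dots> = mat_poly A (r + Polynomial.smult c (monom 1 i)) *\<^sub>v u"
      unfolding r(2) mat_poly_add[OF A] using carr by (simp add: add_mult_distrib_mat_vec[of _ n n])
    finally show ?thesis using r(1) by (intro exI[of _ "r + Polynomial.smult c (monom 1 i)"]) auto
  qed
qed

lemma square_dvd_even_char_poly:
  assumes n: "n \<ge> 1" and deriv: "pderiv (char_poly A) = 0"
  obtains q where "degree q > 0" "q\<^sup>2 dvd char_poly A"
proof -
  define f where "f = char_poly A"
  have fu: "mat_poly A f *\<^sub>v u = 0\<^sub>v n" "mat_poly A f *\<^sub>v x = 0\<^sub>v n" if "x \<in> carrier_vec n" for x
    using Cayley_Hamilton[OF A] that carr by (simp_all add: f_def zero_mat_mult_vec)
  have f0: "f \<noteq> 0" using degree_monic_char_poly[OF A] by (auto simp: f_def)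
  obtain q where q: "q \<noteq> 0" "mat_poly A q *\<^sub>v u = 0\<^sub>v n"
    and least: "\<And>g. g \<noteq> 0 \<Longrightarrow> mat_poly A g *\<^sub>v u = 0\<^sub>v n \<Longrightarrow> degree q \<le> degree g"
    using ex_has_least_nat[of "\<lambda>g. g \<noteq> 0 \<and> mat_poly A g *\<^sub>v u = 0\<^sub>v n" f degree]
      f0 fu(1)[OF u_carrier] by blast
  have "degree q > 0"
  \<comment> \<open>Since \<open>n \<ge> 1\<close>, the vector \<open>u\<close> is nonzero and no
    nonzero constant annihilates it.\<close>
  proof (rule ccontr)
    assume "\<not> degree q > 0"
    then obtain a where a: "q = [:a:]" by (metis degree_eq_zeroE gr0I)
    have "(mat_poly A q *\<^sub>v u) $ 0 = a"
      using n u_carrier A by (simp add: a mat_poly_const smult_mat_mult_vec[of _ n n] u_def)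
    then show False using q n by (simp add: a)
  qed
  moreover have "q\<^sup>2 dvd f"
  proof (rule ccontr)
    assume ndvd: "\<not> q\<^sup>2 dvd f"
    define s t where "s = f div q\<^sup>2" and "t = f mod q\<^sup>2"
    have f: "f = q\<^sup>2 * s + t" by (simp add: s_def t_def)
    have "q\<^sup>2 \<noteq> 0" using q by simp
    have t: "t \<noteq> 0" "degree t < degree (q\<^sup>2)"
      using ndvd degree_mod_less_degree[OF \<open>q\<^sup>2 \<noteq> 0\<close> ndvd] by (auto simp: t_def dvd_eq_mod_eq_0)
    \<comment> \<open>The square has derivative zero, so the derivative of \<open>t\<close> is a
      multiple of \<open>q\<^sup>2\<close>. Its degree is too small unless it is zero; hence both
      \<open>s\<close> and \<open>t\<close> have derivative zero and are even polynomials.\<close>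
    have "0 = q\<^sup>2 * pderiv s + pderiv t"
      using deriv by (simp add: f_def[symmetric] f pderiv_add pderiv_mult pderiv_power2_char_two[OF two])
    then have eq: "pderiv t = - (q\<^sup>2 * pderiv s)" by (simp add: eq_neg_iff_add_eq_0 add.commute)
    have "pderiv t = 0"
    proof (rule ccontr)
      assume nz: "pderiv t \<noteq> 0"
      then have "pderiv s \<noteq> 0" using eq by auto
      then have "degree (pderiv t) \<ge> degree (q\<^sup>2)"
        using eq \<open>q\<^sup>2 \<noteq> 0\<close> by (simp add: degree_mult_eq)
      then show False using degree_pderiv_less[OF nz] t(2) by linarith
    qed
    then have "pderiv s = 0" using eq q by simp
    obtain h where h: "t = even_poly h"
      using pderiv_eq_0_imp_even_poly[OF two \<open>pderiv t = 0\<close>] .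
    obtain k where k: "s = even_poly k"
      using pderiv_eq_0_imp_even_poly[OF two \<open>pderiv s = 0\<close>] .
    have "h \<noteq> 0" using h t by auto
    have "degree h < degree q" using t(2) h by (simp add: degree_power_eq q)
    have form: "x \<bullet> (mat_poly A t *\<^sub>v x) = 0" if x: "x \<in> carrier_vec n" for x
    proof -
      \<comment> \<open>One factor \<open>q\<close> is moved to each side of the scalar product. The
        resulting \<open>y\<close> is orthogonal to the whole Krylov space because \<open>q\<close>
        annihilates \<open>u\<close>, so \<open>s\<close> contributes nothing to the form.\<close>
      define y where "y = mat_poly A q *\<^sub>v x"
      have y: "y \<in> carrier_vec n" using carr by (simp add: y_def)
      have "y \<bullet> (mat_poly A r *\<^sub>v u) = 0" for r
      proof -
        have "y \<bullet> (mat_poly A r *\<^sub>v u) = x \<bullet> (mat_poly A (r * q) *\<^sub>v u)"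
          unfolding y_def mult.commute[of r] using x carr
          by (simp add: mat_poly_mult_vec mat_poly_self_adjoint)
        also have "\<dots> = x \<bullet> (mat_poly A r *\<^sub>v 0\<^sub>v n)"
          using carr by (simp only: mat_poly_mult_vec q(2))
        also have "mat_poly A r *\<^sub>v 0\<^sub>v n = 0\<^sub>v n" using A by (auto intro!: eq_vecI)
        finally show ?thesis using x by simp
      qed
      then have "y \<bullet> (mat_poly A s *\<^sub>v y) = 0" unfolding k using y by (rule even_poly_form_eq_0[rotated])
      moreover have "y \<bullet> (mat_poly A s *\<^sub>v y) = x \<bullet> (mat_poly A (q * (s * q)) *\<^sub>v x)"
        using x y carr by (simp only: mat_poly_mult_vec y_def[symmetric]) (simp add: mat_poly_self_adjoint y_def)
      ultimately have 1: "x \<bullet> (mat_poly A (q\<^sup>2 * s) *\<^sub>v x) = 0"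
        by (simp add: power2_eq_square mult_ac)
      have "x \<bullet> (mat_poly A f *\<^sub>v x) = x \<bullet> (mat_poly A (q\<^sup>2 * s) *\<^sub>v x) + x \<bullet> (mat_poly A t *\<^sub>v x)"
        unfolding f mat_poly_add[OF A] using x carr
        by (simp add: add_mult_distrib_mat_vec[of _ n n] scalar_prod_add_distrib[of _ n])
      then show ?thesis using 1 fu(2)[OF x] x by simp
    qed
    \<comment> \<open>The vanishing form has a nonzero leading coefficient, so a vector orthogonal
      to the Krylov vectors below \<open>degree h\<close> is orthogonal to the next one, which is
      therefore dependent on them.\<close>
    have "\<exists>r. (\<forall>j\<ge>degree h. coeff r j = 0) \<and>
        mat_poly A (monom 1 (degree h)) *\<^sub>v u = mat_poly A r *\<^sub>v u"
    proof (rule Krylov_span)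
      fix x assume x: "x \<in> carrier_vec n"
        and "\<And>j. j < degree h \<Longrightarrow> x \<bullet> (mat_poly A (monom 1 j) *\<^sub>v u) = 0"
      then have "lead_coeff h * (x \<bullet> (mat_poly A (monom 1 (degree h)) *\<^sub>v u))\<^sup>2 = 0"
        using form[OF x] even_poly_form_lead[of x h] by (simp add: h)
      then show "x \<bullet> (mat_poly A (monom 1 (degree h)) *\<^sub>v u) = 0" using \<open>h \<noteq> 0\<close> by simp
    qed (simp add: carr)
    then obtain r where r: "\<forall>j\<ge>degree h. coeff r j = 0"
      "mat_poly A (monom 1 (degree h)) *\<^sub>v u = mat_poly A r *\<^sub>v u" by blast
    \<comment> \<open>This dependence gives an annihilator of \<open>u\<close> of degree below
      \<open>degree q\<close>, against minimality.\<close>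
    define g where "g = monom 1 (degree h) + Polynomial.smult (-1) r"
    have "coeff g (degree h) = 1" using r(1) by (simp add: g_def)
    then have "g \<noteq> 0" by auto
    moreover have "degree g \<le> degree h"
      using r(1) by (intro degree_le) (auto simp: g_def)
    moreover have "mat_poly A g *\<^sub>v u = 0\<^sub>v n"
    proof -
      have "mat_poly A g *\<^sub>v u = mat_poly A r *\<^sub>v u + (-1) \<cdot>\<^sub>v (mat_poly A r *\<^sub>v u)"
        unfolding g_def using carr A
        by (simp add: mat_poly_add mat_poly_smult add_mult_distrib_mat_vec[of _ n n]
            smult_mat_mult_vec[of _ n n] r(2) del: smult_minus_left)
      also have "\<dots> = 0\<^sub>v n" using carr A by (auto intro!: eq_vecI)
      finally show ?thesis .
    qed
    ultimately show False using least[of g] \<open>degree h < degree q\<close> by linarith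
  qed
  ultimately show thesis using that by (simp add: f_def)
qed

end

section \<open>Orthonormal bases in characteristic two\<close>

text \<open>Padding \<open>C\<close> with zero rows gives a singular square matrix with the same
  kernel; singularity is seen on the transpose, which kills \<open>unit_vec n m\<close>.\<close>

lemma wide_mat_kernel:
  fixes C :: "'a :: field mat"
  assumes C: "C \<in> carrier_mat m n" and "m < n"
  obtains w where "w \<in> carrier_vec n" "w \<noteq> 0\<^sub>v n" "C *\<^sub>v w = 0\<^sub>v m"
proof -
  define D where "D = mat n n (\<lambda>(i, j). if i < m then C $$ (i, j) else 0)"
  have D: "D \<in> carrier_mat n n" by (simp add: D_def)
  have "transpose_mat D *\<^sub>v unit_vec n m = 0\<^sub>v n"
    using \<open>m < n\<close> by (intro eq_vecI) (auto simp: D_def)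
  moreover have "unit_vec n m \<noteq> (0\<^sub>v n :: 'a vec)" using \<open>m < n\<close> by simp
  moreover have "unit_vec n m \<in> (carrier_vec n :: 'a vec set)" by simp
  ultimately have "det (transpose_mat D) = 0"
    using iffD2[OF det_0_iff_vec_prod_zero_field[of "transpose_mat D" n]] D transpose_carrier_mat by blast
  then have "det D = 0" using det_transpose[OF D] by simp
  then obtain w where w: "w \<in> carrier_vec n" "w \<noteq> 0\<^sub>v n" "D *\<^sub>v w = 0\<^sub>v n"
    using det_0_iff_vec_prod_zero_field[OF D] by auto
  have "C *\<^sub>v w = 0\<^sub>v m"
  proof (rule eq_vecI)
    fix i assume "i < dim_vec (0\<^sub>v m :: 'a vec)"
    then have i: "i < m" "i < n" using \<open>m < n\<close> by auto
    have "(C *\<^sub>v w) $ i = (D *\<^sub>v w) $ i"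
      using i C w(1) by (auto simp: D_def scalar_prod_def intro!: sum.cong)
    then show "(C *\<^sub>v w) $ i = 0\<^sub>v m $ i" using w i by simp
  qed (use C in auto)
  then show thesis using that w by blast
qed

context
  fixes B :: "'a :: field mat" and n :: nat and b
  assumes B: "B \<in> carrier_mat n n" and sym: "transpose_mat B = B"
    and two: "(2 :: 'a) = 0"
    and square: "\<And>x. x \<in> carrier_vec n \<Longrightarrow> \<exists>c. x \<bullet> (B *\<^sub>v x) = c\<^sup>2"
  defines "b \<equiv> \<lambda>x y. x \<bullet> (B *\<^sub>v y)"
begin

lemma form_vec_carrier: "B *\<^sub>v x \<in> carrier_vec n"
  using B by (metis carrier_matD(1) dim_mult_mat_vec carrier_vec_dim_vec)

lemma form_commute:
  assumes "x \<in> carrier_vec n" "y \<in> carrier_vec n"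
  shows "b x y = b y x"
proof -
  have "b x y = (B *\<^sub>v x) \<bullet> y"
    using transpose_vec_mult_scalar[OF B assms(2,1)] by (simp add: sym b_def)
  then show ?thesis using comm_scalar_prod[OF form_vec_carrier assms(2)] by (simp add: b_def)
qed

lemma form_add:
  assumes "x \<in> carrier_vec n" "y \<in> carrier_vec n" "z \<in> carrier_vec n"
  shows "b (x + y) z = b x z + b y z" "b z (x + y) = b z x + b z y"
proof -
  show "b (x + y) z = b x z + b y z"
    using assms form_vec_carrier by (simp add: b_def add_scalar_prod_distrib[of _ n])
  then show "b z (x + y) = b z x + b z y"
    using assms by (simp add: form_commute[of z])
qed

lemma form_smult:
  assumes "x \<in> carrier_vec n" "y \<in> carrier_vec n"
  shows "b (c \<cdot>\<^sub>v x) y = c * b x y" "b x (c \<cdot>\<^sub>v y) = c * b x y"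
proof -
  have *: "b (c \<cdot>\<^sub>v x) y = c * b x y" if "x \<in> carrier_vec n" "y \<in> carrier_vec n" for x y
    using that form_vec_carrier by (simp add: b_def)
  then show "b (c \<cdot>\<^sub>v x) y = c * b x y" "b x (c \<cdot>\<^sub>v y) = c * b x y"
    using assms *[of y x] by (simp_all add: form_commute[of x])
qed

text \<open>A list, so that it can serve as the columns of a matrix. Orthogonality is required only
  in list order; symmetry of \<open>b\<close> supplies the rest.\<close>

definition orthonormal :: "'a vec list \<Rightarrow> bool" where
  "orthonormal vs \<longleftrightarrow> set vs \<subseteq> carrier_vec n \<and> (\<forall>v\<in>set vs. b v v = 1) \<and>
    sorted_wrt (\<lambda>v w. b v w = 0) vs"

lemma orthonormal_Cons:
  "orthonormal (v # vs) \<longleftrightarrow>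
    v \<in> carrier_vec n \<and> b v v = 1 \<and> (\<forall>w\<in>set vs. b v w = 0) \<and> orthonormal vs"
  by (auto simp: orthonormal_def)

text \<open>The identity exhibits \<open>transpose_mat P * B\<close> as a left inverse of
  \<open>P\<close>. It yields independence of the family, the projection onto its span, and finally
  the change of basis.\<close>

lemma orthonormal_Gram:
  assumes "orthonormal vs"
  defines "P \<equiv> mat_of_cols n vs"
  shows "transpose_mat P * B * P = 1\<^sub>m (length vs)"
proof (rule eq_matI)
  let ?m = "length vs"
  have P: "P \<in> carrier_mat n ?m" by (simp add: P_def)
  fix i j assume "i < dim_row (1\<^sub>m ?m :: 'a mat)" "j < dim_col (1\<^sub>m ?m :: 'a mat)"
  then have ij: "i < ?m" "j < ?m" by auto
  have vs: "vs ! k \<in> carrier_vec n" if "k < ?m" for k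
    using assms(1) that by (auto simp: orthonormal_def)
  have "transpose_mat P * B * P = transpose_mat P * (B * P)"
    using P B by (simp add: assoc_mult_mat[of _ ?m n _ n _ ?m])
  then have "(transpose_mat P * B * P) $$ (i, j) = col P i \<bullet> (B *\<^sub>v col P j)"
    using ij P B by (simp add: mult_mat_vec_def)
  also have "\<dots> = b (vs ! i) (vs ! j)" using ij vs by (simp add: P_def b_def)
  also have "\<dots> = (if i = j then 1 else 0)"
  proof -
    have "b (vs ! k) (vs ! l) = 0" if "k < l" "l < ?m" for k l
      using assms(1) that sorted_wrt_nth_less by (fastforce simp: orthonormal_def)
    then show ?thesis
      using assms(1) ij form_commute[OF vs vs, of i j]
      by (cases i j rule: linorder_cases) (auto simp: orthonormal_def)
  qed
  finally show "(transpose_mat P * B * P) $$ (i, j) = 1\<^sub>m ?m $$ (i, j)" using ij by simp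
qed (auto simp: P_def)

text \<open>In the orthogonal complement \<open>W\<close> of a maximal orthonormal family, all vectors are isotropic,
  since values of the form are squares. If \<open>W\<close> were nonzero, it would contain a hyperbolic pair
  \<open>w\<close>, \<open>w'\<close>, and a member \<open>e\<close> of the family could be replaced by the three orthonormal vectors
  \<open>e + w\<close>, \<open>e + w'\<close>, \<open>e + w + w'\<close>.\<close>

lemma orthonormal_extend:
  assumes nondeg: "det B \<noteq> 0" and vs: "orthonormal vs" "vs \<noteq> []" "length vs < n"
  obtains vs' where "orthonormal vs'" "length vs' > length vs"
proof -
  let ?m = "length vs"
  define P where "P = mat_of_cols n vs"
  have P: "P \<in> carrier_mat n ?m" by (simp add: P_def)
  \<comment> \<open>The kernel of \<open>Q\<close> is the orthogonal complement of the family, and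
    \<open>P * Q\<close> is the orthogonal projection onto its span.\<close>
  define Q where "Q = transpose_mat P * B"
  have Q: "Q \<in> carrier_mat ?m n" using P B by (simp add: Q_def)
  have QP: "Q * P = 1\<^sub>m ?m" using orthonormal_Gram[OF vs(1)] by (simp add: Q_def P_def)
  have Q0: "(\<forall>v\<in>set vs. b v x = 0)" if "x \<in> carrier_vec n" "Q *\<^sub>v x = 0\<^sub>v ?m" for x
  proof -
    have "b (vs ! i) x = 0" if "i < ?m" for i
    proof -
      have "(Q *\<^sub>v x) $ i = (transpose_mat P *\<^sub>v (B *\<^sub>v x)) $ i"
        using \<open>x \<in> carrier_vec n\<close> P B by (simp add: Q_def assoc_mult_mat_vec[of _ ?m n _ n])
      also have "\<dots> = vs ! i \<bullet> (B *\<^sub>v x)"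
        using that vs(1) P nth_mem[OF that] by (auto simp: P_def orthonormal_def col_mat_of_cols subsetD)
      finally show ?thesis using \<open>Q *\<^sub>v x = 0\<^sub>v ?m\<close> that by (simp add: b_def)
    qed
    then show ?thesis by (auto simp: in_set_conv_nth)
  qed
  show thesis
  proof (cases "\<exists>w\<in>carrier_vec n. (\<forall>v\<in>set vs. b v w = 0) \<and> b w w \<noteq> 0")
    case True
    then obtain w where w: "w \<in> carrier_vec n" "\<forall>v\<in>set vs. b v w = 0" "b w w \<noteq> 0" by blast
    \<comment> \<open>Because the value is a square, the anisotropic vector \<open>w\<close> can be
      scaled to value 1.\<close>
    obtain c where c: "b w w = c\<^sup>2" using square w(1) by (auto simp: b_def)
    define v where "v = inverse c \<cdot>\<^sub>v w"
    have "c \<noteq> 0" using c w(3) by auto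
    then have "b v v = 1" using w(1) c by (simp add: v_def form_smult power2_eq_square field_simps)
    moreover have "b v u = 0" if "u \<in> set vs" for u
      using that w vs(1) form_commute[of w u] by (auto simp: v_def form_smult orthonormal_def)
    ultimately have "orthonormal (v # vs)" using w(1) vs(1) by (simp add: orthonormal_Cons v_def)
    then show thesis using that[of "v # vs"] by simp
  next
    case False
    obtain w where w: "w \<in> carrier_vec n" "w \<noteq> 0\<^sub>v n" "Q *\<^sub>v w = 0\<^sub>v ?m"
      using wide_mat_kernel[OF Q vs(3)] .
    have "B *\<^sub>v w \<noteq> 0\<^sub>v n" using det_0_iff_vec_prod_zero_field[OF B] nondeg w by blast
    then obtain i where i: "i < n" "(B *\<^sub>v w) $ i \<noteq> 0"
      using form_vec_carrier[of w] by (metis carrier_vecD eq_vecI index_zero_vec)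
    \<comment> \<open>The component of a unit vector in the complement. As \<open>w\<close> is
      orthogonal to the span, removing the projection does not change the nonzero pairing with
      \<open>w\<close>.\<close>
    define y where "y = unit_vec n i - P *\<^sub>v (Q *\<^sub>v unit_vec n i)"
    have y: "y \<in> carrier_vec n" using P Q by (simp add: y_def)
    have "Q *\<^sub>v y = Q *\<^sub>v unit_vec n i - (Q * P) *\<^sub>v (Q *\<^sub>v unit_vec n i)"
      using P Q by (simp add: y_def mult_minus_distrib_mat_vec[of _ ?m n] assoc_mult_mat_vec[of _ ?m n _ ?m])
    also have "\<dots> = 0\<^sub>v ?m" using Q by (simp add: QP)
    finally have Qy: "Q *\<^sub>v y = 0\<^sub>v ?m" .
    have wP: "b w (P *\<^sub>v z) = 0" if "z \<in> carrier_vec ?m" for z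
    proof -
      have "b w (P *\<^sub>v z) = (P *\<^sub>v z) \<bullet> (B *\<^sub>v w)"
        using P that w(1) form_commute[of w "P *\<^sub>v z"] by (simp add: b_def)
      also have "\<dots> = z \<bullet> (transpose_mat P *\<^sub>v (B *\<^sub>v w))"
        using transpose_vec_mult_scalar[of "transpose_mat P" ?m n "B *\<^sub>v w" z] P that form_vec_carrier by simp
      also have "transpose_mat P *\<^sub>v (B *\<^sub>v w) = 0\<^sub>v ?m"
        using w P B by (simp add: Q_def assoc_mult_mat_vec[of _ ?m n _ n])
      finally show ?thesis using that by simp
    qed
    have "b w y = b w (unit_vec n i) - b w (P *\<^sub>v (Q *\<^sub>v unit_vec n i))"
      using w(1) P Q B by (simp add: y_def b_def mult_minus_distrib_mat_vec[of _ n n] scalar_prod_minus_distrib[of _ n])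
    also have "\<dots> = (B *\<^sub>v w) $ i"
      using w(1) Q i form_vec_carrier[of w] form_commute[of w "unit_vec n i"] wP[of "Q *\<^sub>v unit_vec n i"]
      by (simp add: b_def)
    finally have wy: "b w y \<noteq> 0" using i by simp
    define w' where "w' = inverse (b w y) \<cdot>\<^sub>v y"
    have w': "w' \<in> carrier_vec n" using y by (simp add: w'_def)
    have ww': "b w w' = 1" "b w' w = 1"
      using w(1) y wy form_commute[OF w(1) y] by (simp_all add: w'_def form_smult)
    have iso: "b w w = 0" "b w' w' = 0"
      using False Q0 w y Qy by (auto simp: w'_def form_smult)
    obtain e es where vs_eq: "vs = e # es" using vs(2) by (cases vs) auto
    have e: "e \<in> carrier_vec n" "b e e = 1" "\<forall>v\<in>set es. b e v = 0" "orthonormal es"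
      using vs(1) by (auto simp: vs_eq orthonormal_Cons)
    have vsw: "b v w = 0" "b v w' = 0" "b w v = 0" "b w' v = 0" if "v \<in> set vs" for v
    proof -
      have "v \<in> carrier_vec n" using vs(1) that by (auto simp: orthonormal_def)
      moreover show "b v w = 0" using Q0 w that by blast
      moreover show "b v w' = 0"
        using Q0[OF y Qy] that y \<open>v \<in> carrier_vec n\<close> by (simp add: w'_def form_smult)
      ultimately show "b w v = 0" "b w' v = 0" using form_commute w w' by metis+
    qed
    have es: "v \<in> carrier_vec n" if "v \<in> set es" for v
      using e(4) that by (auto simp: orthonormal_def)
    \<comment> \<open>Each of the three vectors has value 1 and each pair has product 1 + 1 = 0,
      since \<open>w\<close> and \<open>w'\<close> are isotropic with product 1.\<close>
    have "orthonormal ((e + w) # (e + w') # (e + w + w') # es)"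
      unfolding orthonormal_Cons using e w(1) w' es vsw iso ww' char_two_add_self[OF two, of 1]
      by (simp add: vs_eq form_add add.assoc)
    then show thesis using that by (fastforce simp: vs_eq)
  qed
qed

text \<open>\<open>P\<close> has a left inverse, so it is injective and cannot have more columns
  than rows.\<close>

lemma orthonormal_length_le:
  assumes "orthonormal vs"
  shows "length vs \<le> n"
proof (rule ccontr)
  let ?m = "length vs"
  define P where "P = mat_of_cols n vs"
  have P: "P \<in> carrier_mat n ?m" by (simp add: P_def)
  assume "\<not> length vs \<le> n"
  then obtain w where w: "w \<in> carrier_vec ?m" "w \<noteq> 0\<^sub>v ?m" "P *\<^sub>v w = 0\<^sub>v n"
    using wide_mat_kernel[OF P] by (metis not_le)
  have "w = (transpose_mat P * B * P) *\<^sub>v w"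
    using orthonormal_Gram[OF assms] w(1) by (simp add: P_def)
  also have "\<dots> = (transpose_mat P * B) *\<^sub>v 0\<^sub>v n"
    using P B w by (simp add: assoc_mult_mat_vec[of _ ?m n _ ?m])
  also have "\<dots> = 0\<^sub>v ?m"
  proof (rule eq_vecI)
    fix i assume "i < dim_vec (0\<^sub>v ?m :: 'a vec)"
    moreover have "transpose_mat P * B \<in> carrier_mat ?m n" using P B by simp
    ultimately show "((transpose_mat P * B) *\<^sub>v 0\<^sub>v n) $ i = 0\<^sub>v ?m $ i" by (simp del: index_mult_mat)
  qed (use P in simp)
  finally show False using w by simp
qed

text \<open>Scaling \<open>x\<close> gives an orthonormal family with one member; a longest nonempty
  one has \<open>n\<close> members. Nonemptiness is carried along because the extension needs a
  member to replace.\<close>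

lemma Gram_factorization:
  assumes nondeg: "det B \<noteq> 0" and nonalt: "x \<in> carrier_vec n" "x \<bullet> (B *\<^sub>v x) \<noteq> 0"
  obtains P where "P \<in> carrier_mat n n" "transpose_mat P * B * P = 1\<^sub>m n"
proof -
  obtain c where c: "b x x = c\<^sup>2" using square nonalt(1) by (auto simp: b_def)
  have "c \<noteq> 0" using c nonalt(2) by (auto simp: b_def)
  then have "orthonormal [inverse c \<cdot>\<^sub>v x]"
    using nonalt(1) c by (simp add: orthonormal_def form_smult power2_eq_square field_simps)
  then obtain vs where vs: "orthonormal vs" "vs \<noteq> []"
    and max: "\<And>vs'. orthonormal vs' \<Longrightarrow> vs' \<noteq> [] \<Longrightarrow> length vs' \<le> length vs"
    using ex_has_greatest_nat[of "\<lambda>vs. orthonormal vs \<and> vs \<noteq> []" "[inverse c \<cdot>\<^sub>v x]" length "Suc n"]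
      orthonormal_length_le by (metis le_imp_less_Suc list.distinct(1))
  have "length vs = n"
  proof (rule ccontr)
    assume "length vs \<noteq> n"
    then have "length vs < n" using orthonormal_length_le[OF vs(1)] by simp
    then obtain vs' where "orthonormal vs'" "length vs' > length vs"
      using orthonormal_extend[OF nondeg vs] by blast
    then show False using max[of vs'] by force
  qed
  then show thesis using that[of "mat_of_cols n vs"] orthonormal_Gram[OF vs(1)] by auto
qed

end

text \<open>In the orthonormal basis given by \<open>P\<close>, a self-adjoint endomorphism has a
  symmetric matrix; the inverse of \<open>P\<close> is \<open>transpose_mat P * B\<close>.\<close>

lemma symmetric_similar_if_self_adjoint:
  fixes A B :: "'a :: field mat"
  assumes A: "A \<in> carrier_mat n n" and B: "B \<in> carrier_mat n n"
    and sym: "transpose_mat (B * A) = B * A"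
    and P: "P \<in> carrier_mat n n" "transpose_mat P * B * P = 1\<^sub>m n"
  shows "\<exists>C\<in>carrier_mat n n. symmetric_mat C \<and> char_poly C = char_poly A"
proof
  define Q where "Q = transpose_mat P * B"
  have Q: "Q \<in> carrier_mat n n" using P B by (simp add: Q_def)
  have QP: "Q * P = 1\<^sub>m n" using P by (simp add: Q_def)
  then have PQ: "P * Q = 1\<^sub>m n" using mat_mult_left_right_inverse Q P(1) by blast
  define C where "C = Q * A * P"
  show C: "C \<in> carrier_mat n n" using Q A P by (simp add: C_def)
  have "similar_mat C A"
    using Q A P C QP PQ by (intro similar_matI[of _ _ Q P n]) (auto simp: C_def)
  moreover have "transpose_mat C = C"
  proof -
    define S where "S = B * A"
    have S: "S \<in> carrier_mat n n" "transpose_mat S = S" using A B sym by (auto simp: S_def)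
    have "C = transpose_mat P * (S * P)"
      using P(1) A B by (simp add: C_def Q_def S_def assoc_mult_mat[of _ n n _ n _ n])
    then show ?thesis
      using P(1) S by (simp add: transpose_mult[of _ n n _ n] assoc_mult_mat[of _ n n _ n _ n])
  qed
  ultimately show "symmetric_mat C \<and> char_poly C = char_poly A"
    by (simp add: symmetric_mat_def char_poly_similar)
qed

section \<open>Self-adjoint endomorphisms\<close>

definition self_adjoint_pair :: "nat \<Rightarrow> 'a :: field mat \<Rightarrow> 'a mat \<Rightarrow> bool" where
  "self_adjoint_pair n A B \<longleftrightarrow> A \<in> carrier_mat n n \<and> B \<in> carrier_mat n n \<and>
    transpose_mat B = B \<and> transpose_mat (B * A) = B * A \<and> det B \<noteq> 0 \<and>
    (\<forall>x\<in>carrier_vec n. \<exists>c. x \<bullet> (B *\<^sub>v x) = c\<^sup>2)"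

definition alternating_form :: "nat \<Rightarrow> 'a :: field mat \<Rightarrow> bool" where
  "alternating_form n B \<longleftrightarrow> (\<forall>x\<in>carrier_vec n. x \<bullet> (B *\<^sub>v x) = 0)"

lemma coeff_mult_top:
  fixes p q :: "'a :: comm_semiring_0 poly"
  assumes "degree p \<le> a" "degree q \<le> b"
  shows "coeff (p * q) (a + b) = coeff p a * coeff q b"
proof (cases "degree p = a \<and> degree q = b")
  case True
  then show ?thesis using coeff_mult_degree_sum[of p q] by simp
next
  case False
  then have "degree p + degree q < a + b" using assms by linarith
  then have "coeff (p * q) (a + b) = 0"
    using degree_mult_le[of p q] by (intro coeff_eq_0) linarith
  moreover have "coeff p a * coeff q b = 0" using False assms by (auto simp: coeff_eq_0)
  ultimately show ?thesis by simp
qed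

lemma poly_eq_sum_monom:
  assumes "\<And>i. i \<ge> n \<Longrightarrow> coeff p i = 0"
  shows "p = (\<Sum>i<n. monom (coeff p i) i)"
proof (rule poly_eqI)
  fix i
  show "coeff p i = coeff (\<Sum>i<n. monom (coeff p i) i) i"
    using assms[of i] by (cases "i < n") (auto simp: coeff_sum)
qed

section \<open>The algebra k[X]/(f) with its twisted residue form\<close>

context
  fixes f r :: "'a :: field poly" and n :: nat
  assumes f: "monic f" "degree f = n" "n \<ge> 1"
begin

private lemma f_nz: "f \<noteq> 0"
  using f by auto

lemma coeff_mod_f: "i \<ge> n \<Longrightarrow> coeff (g mod f) i = 0"
  using degree_mod_less'[OF f_nz, of g] f(2) by (cases "g mod f = 0") (auto simp: coeff_eq_0)

text \<open>Coordinates of the class of \<open>g\<close> modulo \<open>f\<close> in the basis of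
  powers of X.\<close>

definition residue_vec :: "'a poly \<Rightarrow> 'a vec" where
  "residue_vec g = vec n (coeff (g mod f))"

text \<open>The functional \<tau> of the overview, with the twist by \<open>r\<close> built
  in.\<close>

definition residue_functional :: "'a poly \<Rightarrow> 'a" where
  "residue_functional g = coeff ((r * g) mod f) (n - 1)"

text \<open>The companion matrix of \<open>f\<close>.\<close>

definition residue_mult :: "'a mat" where
  "residue_mult = mat n n (\<lambda>(i, j). coeff (monom 1 (Suc j) mod f) i)"

text \<open>The Gram matrix, of Hankel shape, of the form sending (g, h) to \<tau>(r g h).\<close>

definition residue_form :: "'a mat" where
  "residue_form = mat n n (\<lambda>(i, j). residue_functional (monom 1 (i + j)))"

lemma residue_carrier [simp]:
  "residue_vec g \<in> carrier_vec n" "residue_mult \<in> carrier_mat n n" "residue_form \<in> carrier_mat n n"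
  by (auto simp: residue_vec_def residue_mult_def residue_form_def)

lemma residue_vec_add: "residue_vec (g + h) = residue_vec g + residue_vec h"
  by (intro eq_vecI) (auto simp: residue_vec_def poly_mod_add_left)

lemma residue_vec_smult: "residue_vec (Polynomial.smult c g) = c \<cdot>\<^sub>v residue_vec g"
  by (intro eq_vecI) (auto simp: residue_vec_def mod_smult_left)

lemma residue_vec_eq_0_iff: "residue_vec g = 0\<^sub>v n \<longleftrightarrow> f dvd g"
proof
  assume *: "residue_vec g = 0\<^sub>v n"
  have "coeff (g mod f) i = 0" for i
    using arg_cong[OF *, of "\<lambda>v. vec_index v i"] coeff_mod_f[of i g] by (cases "i < n") (auto simp: residue_vec_def)
  then show "f dvd g" by (simp add: poly_eq_iff dvd_eq_mod_eq_0)
qed (auto simp: residue_vec_def)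

lemma residue_vec_monom: "i < n \<Longrightarrow> residue_vec (monom 1 i) = unit_vec n i"
  using f by (intro eq_vecI) (auto simp: residue_vec_def mod_poly_less degree_monom_eq)

lemma residue_vec_surj:
  assumes "x \<in> carrier_vec n"
  obtains g where "x = residue_vec g"
proof
  let ?g = "\<Sum>i<n. monom (x $ i) i"
  have "degree ?g < n"
    using f(3) by (intro degree_lessI) (auto simp: coeff_sum)
  then have "?g mod f = ?g" using f by (simp add: mod_poly_less)
  then show "x = residue_vec ?g"
    using assms by (intro eq_vecI) (auto simp: residue_vec_def coeff_sum)
qed

lemma residue_functional_add: "residue_functional (g + h) = residue_functional g + residue_functional h"
  by (simp add: residue_functional_def ring_distribs poly_mod_add_left)

lemma residue_functional_smult: "residue_functional (Polynomial.smult c g) = c * residue_functional g"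
  by (simp add: residue_functional_def mod_smult_left)

lemma residue_functional_sum: "residue_functional (sum g S) = (\<Sum>i\<in>S. residue_functional (g i))"
proof (cases "finite S")
  case True
  then show ?thesis
    by (induction S) (simp_all add: residue_functional_add, simp add: residue_functional_def)
qed (simp add: residue_functional_def)

lemma residue_functional_mod:
  "residue_functional ((g mod f) * (h mod f)) = residue_functional (g * h)"
  unfolding residue_functional_def by (metis mod_mult_eq mod_mult_right_eq)

lemma residue_form_eq: "residue_vec g \<bullet> (residue_form *\<^sub>v residue_vec h) = residue_functional (g * h)"
proof -
  let ?g = "g mod f" and ?h = "h mod f"
  have "?g * ?h = (\<Sum>i<n. monom (coeff ?g i) i) * (\<Sum>j<n. monom (coeff ?h j) j)"
    by (intro arg_cong2[of _ _ _ _ "(*)"] poly_eq_sum_monom coeff_mod_f)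
  also have "\<dots> = (\<Sum>i<n. \<Sum>j<n. Polynomial.smult (coeff ?g i * coeff ?h j) (monom 1 (i + j)))"
    by (simp add: sum_product mult_monom smult_monom)
  finally have "residue_functional (?g * ?h) =
      (\<Sum>i<n. \<Sum>j<n. coeff ?g i * coeff ?h j * residue_functional (monom 1 (i + j)))"
    by (simp add: residue_functional_sum residue_functional_smult)
  also have "\<dots> = residue_vec g \<bullet> (residue_form *\<^sub>v residue_vec h)"
    by (simp add: residue_vec_def residue_form_def scalar_prod_def sum_distrib_left mult_ac lessThan_atLeast0)
  finally show ?thesis by (simp add: residue_functional_mod)
qed

lemma residue_mult_eq: "residue_mult *\<^sub>v residue_vec g = residue_vec ([:0, 1:] * g)"
proof (rule eq_vecI)
  let ?g = "g mod f"
  fix i assume "i < dim_vec (residue_vec ([:0, 1:] * g))"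
  then have i: "i < n" by (simp add: residue_vec_def)
  have sum_mod: "(\<Sum>j\<in>S. h j) mod f = (\<Sum>j\<in>S. h j mod f)" if "finite S" for S :: "nat set" and h
    using that by (induction S) (auto simp: poly_mod_add_left)
  have "[:0, 1:] * ?g = [:0, 1:] * (\<Sum>j<n. monom (coeff ?g j) j)"
    by (intro arg_cong2[of _ _ _ _ "(*)"] poly_eq_sum_monom coeff_mod_f refl)
  also have "\<dots> = (\<Sum>j<n. Polynomial.smult (coeff ?g j) (monom 1 (Suc j)))"
    unfolding sum_distrib_left by (simp add: smult_monom monom_Suc)
  finally have "([:0, 1:] * ?g) mod f = (\<Sum>j<n. Polynomial.smult (coeff ?g j) (monom 1 (Suc j) mod f))"
    by (simp only: sum_mod[OF finite_lessThan] mod_smult_left)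
  then have "([:0, 1:] * g) mod f = (\<Sum>j<n. Polynomial.smult (coeff ?g j) (monom 1 (Suc j) mod f))"
    by (simp only: mod_mult_right_eq)
  then show "(residue_mult *\<^sub>v residue_vec g) $ i = residue_vec ([:0, 1:] * g) $ i"
    using i by (simp only: residue_vec_def residue_mult_def)
      (simp add: scalar_prod_def coeff_sum mult.commute lessThan_atLeast0)
qed (simp add: residue_vec_def residue_mult_def)

lemma residue_mult_mat_poly: "mat_poly residue_mult g *\<^sub>v residue_vec h = residue_vec (g * h)"
proof (induction g arbitrary: h)
  case 0
  have "residue_vec 0 = 0\<^sub>v n" by (simp add: residue_vec_eq_0_iff)
  then show ?case by (simp add: zero_mat_mult_vec mat_poly_0[OF residue_carrier(2)])
next
  case (pCons a g)
  have "mat_poly residue_mult (pCons a g) *\<^sub>v residue_vec h =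
      a \<cdot>\<^sub>v residue_vec h + mat_poly residue_mult g *\<^sub>v residue_vec ([:0, 1:] * h)"
    by (simp only: mat_poly_pCons_vec[OF residue_carrier(2,1)] residue_mult_eq)
  also have "\<dots> = residue_vec (Polynomial.smult a h + g * ([:0, 1:] * h))"
    by (simp only: pCons residue_vec_add residue_vec_smult)
  also have "Polynomial.smult a h + g * ([:0, 1:] * h) = pCons a g * h" by simp
  finally show ?case .
qed

text \<open>Cayley-Hamilton, applied to the class of 1, shows that \<open>f\<close> divides the
  characteristic polynomial; both are monic of degree \<open>n\<close>.\<close>

lemma char_poly_residue_mult: "char_poly residue_mult = f"
proof -
  let ?\<chi> = "char_poly residue_mult"
  have "residue_vec (?\<chi> * 1) = 0\<^sub>v n"
    unfolding residue_mult_mat_poly[symmetric]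
    by (simp add: Cayley_Hamilton[OF residue_carrier(2)] zero_mat_mult_vec)
  then have "f dvd ?\<chi>" by (simp add: residue_vec_eq_0_iff)
  then obtain c where c: "?\<chi> = f * c" by blast
  have chi: "degree ?\<chi> = n" "monic ?\<chi>"
    using degree_monic_char_poly[OF residue_carrier(2)] by auto
  then have "c \<noteq> 0" using c by auto
  then have "degree c = 0" using c chi(1) f f_nz by (simp add: degree_mult_eq)
  then obtain a where a: "c = [:a:]" by (metis degree_eq_zeroE)
  have "a = 1" using c chi(2) f(1) by (metis a lead_coeff_mult lead_coeff_pCons(2) mult_1)
  then show ?thesis using c a by (simp flip: one_pCons)
qed

text \<open>Let \<open>t\<close> and \<open>w\<close> be the remainders of
  \<open>r * g\<^sup>2\<close> and \<open>s * g\<close>. Differentiating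
  \<open>r * g\<^sup>2 * f\<close> in two ways and comparing modulo \<open>f\<^sup>2\<close> gives
  \<open>pderiv (t * f) = w\<^sup>2\<close>; the top coefficients are the two sides of the
  claim.\<close>

lemma residue_form_square:
  assumes two: "(2 :: 'a) = 0" and s: "pderiv (r * f) = s\<^sup>2"
  shows "residue_functional (g\<^sup>2) = (coeff ((s * g) mod f) (n - 1))\<^sup>2"
proof -
  define c t where "c = (r * g\<^sup>2) div f" and "t = (r * g\<^sup>2) mod f"
  define a w where "a = (s * g) div f" and "w = (s * g) mod f"
  have ct: "r * g\<^sup>2 = c * f + t" and aw: "s * g = a * f + w"
    by (simp_all add: c_def t_def a_def w_def)
  have dt: "degree t \<le> n - 1" "degree w \<le> n - 1"
    using f(3) coeff_mod_f by (auto intro!: degree_le simp: t_def w_def)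
  note two' = char_two_poly[OF two]
  have "pderiv (r * g\<^sup>2 * f) = pderiv ((r * f) * g\<^sup>2)" by (simp add: mult_ac)
  also have "\<dots> = (s * g)\<^sup>2"
    unfolding pderiv_mult[of "r * f"] s pderiv_power2_char_two[OF two] by (simp add: power_mult_distrib mult.commute)
  also have "\<dots> = a\<^sup>2 * f\<^sup>2 + w\<^sup>2"
    unfolding aw char_two_power2_add[OF two'] by (simp add: power_mult_distrib)
  finally have "pderiv (c * f\<^sup>2 + t * f) = a\<^sup>2 * f\<^sup>2 + w\<^sup>2"
    unfolding ct by (simp add: algebra_simps power2_eq_square)
  then have "f\<^sup>2 * pderiv c + pderiv (t * f) = a\<^sup>2 * f\<^sup>2 + w\<^sup>2"
    unfolding pderiv_add pderiv_mult[of c] pderiv_power2_char_two[OF two] by simp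
  then have eq: "pderiv (t * f) - w\<^sup>2 = (a\<^sup>2 - pderiv c) * f\<^sup>2"
    by (simp add: algebra_simps)
  \<comment> \<open>Both terms have degree at most 2n - 2, whereas a nonzero multiple of
    \<open>f\<^sup>2\<close> has degree at least 2n.\<close>
  have "degree (pderiv (t * f) - w\<^sup>2) < 2 * n"
  proof (rule degree_lessI)
    have "coeff (t * f) (Suc i) = 0" if "i \<ge> 2 * n" for i
      using that degree_mult_le[of t f] dt f by (intro coeff_eq_0) linarith
    moreover have "coeff (w\<^sup>2) i = 0" if "i \<ge> 2 * n" for i
      unfolding power2_eq_square using that degree_mult_le[of w w] dt f by (intro coeff_eq_0) linarith
    ultimately show "\<forall>k\<ge>2 * n. coeff (pderiv (t * f) - w\<^sup>2) k = 0"
      by (simp add: coeff_pderiv)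
  qed (use f in simp)
  moreover have "degree ((a\<^sup>2 - pderiv c) * f\<^sup>2) \<ge> 2 * n" if "a\<^sup>2 - pderiv c \<noteq> 0"
    using that f f_nz by (simp add: degree_mult_eq degree_power_eq)
  ultimately have "a\<^sup>2 - pderiv c = 0" using eq by (metis leD)
  then have "pderiv (t * f) = w\<^sup>2" using eq by simp
  \<comment> \<open>The index 2n - 2 is even, so the derivative reads off the coefficient of
    \<open>t * f\<close> at 2n - 1, the highest index possible; \<open>f\<close> is monic.\<close>
  moreover have "coeff (pderiv (t * f)) (2 * (n - 1)) = coeff t (n - 1)"
  proof -
    have "Suc (2 * (n - 1)) = n - 1 + n" using f(3) by linarith
    then have "coeff (pderiv (t * f)) (2 * (n - 1)) = coeff (t * f) (n - 1 + n)"
      by (simp only: coeff_pderiv_char_two[OF two]) simp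
    also have "\<dots> = coeff t (n - 1)" using coeff_mult_top[OF dt(1), of f n] f by simp
    finally show ?thesis .
  qed
  moreover have "coeff (w\<^sup>2) (2 * (n - 1)) = (coeff w (n - 1))\<^sup>2"
    using coeff_mult_top[OF dt(2) dt(2)] by (simp add: power2_eq_square mult_2)
  ultimately show ?thesis by (simp add: residue_functional_def t_def w_def)
qed

text \<open>A power of X raises the degree of the nonzero remainder to exactly \<open>n - 1\<close>,
  so no reduction modulo \<open>f\<close> takes place.\<close>

lemma coeff_top_nonzero:
  assumes "\<not> f dvd g"
  obtains h where "coeff ((g * h) mod f) (n - 1) \<noteq> 0"
proof
  let ?g = "g mod f"
  have nz: "?g \<noteq> 0" using assms by (simp add: dvd_eq_mod_eq_0)
  have deg: "degree ?g < n" using degree_mod_less'[OF f_nz nz] f by simp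
  let ?h = "monom 1 (n - 1 - degree ?g) :: 'a poly"
  have "degree (?g * ?h) = n - 1" using nz deg by (simp add: degree_mult_eq degree_monom_eq)
  then have "(?g * ?h) mod f = ?g * ?h" using f by (simp add: mod_poly_less)
  moreover have "coeff (?g * ?h) (n - 1) \<noteq> 0"
    using \<open>degree (?g * ?h) = n - 1\<close> nz by (metis leading_coeff_0_iff monom_eq_0_iff mult_eq_0_iff zero_neq_one)
  ultimately show "coeff ((g * ?h) mod f) (n - 1) \<noteq> 0" by (metis mod_mult_left_eq)
qed

text \<open>Coprimality of \<open>r\<close> and \<open>f\<close> enters as cancellation of
  \<open>r\<close> modulo \<open>f\<close>, which makes the form nondegenerate. Its diagonal values
  are the squares of \<tau>(s g), so it is not alternating once \<open>s\<close> is nonzero modulo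
  \<open>f\<close>.\<close>

lemma residue_pair:
  assumes two: "(2 :: 'a) = 0" and s: "pderiv (r * f) = s\<^sup>2"
    and coprime: "\<And>g. f dvd r * g \<Longrightarrow> f dvd g"
  shows "self_adjoint_pair n residue_mult residue_form"
    and "\<not> f dvd s \<Longrightarrow> \<not> alternating_form n residue_form"
proof -
  have "transpose_mat residue_form = residue_form"
    by (rule eq_matI) (auto simp: residue_form_def add.commute)
  moreover have "transpose_mat (residue_form * residue_mult) = residue_form * residue_mult"
  proof -
    \<comment> \<open>The entry depends on \<open>i + j\<close> only, whence the symmetry of the
      product.\<close>
    have entry: "(residue_form * residue_mult) $$ (i, j) = residue_functional (monom 1 (Suc (i + j)))"
      if "i < n" "j < n" for i j
    proof -
      have "M $$ (i, j) = unit_vec n i \<bullet> (M *\<^sub>v unit_vec n j)" if "M \<in> carrier_mat n n" for M :: "'a mat"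
        using that \<open>i < n\<close> \<open>j < n\<close> by simp
      then have "(residue_form * residue_mult) $$ (i, j) =
          unit_vec n i \<bullet> ((residue_form * residue_mult) *\<^sub>v unit_vec n j)"
        by (meson mult_carrier_mat residue_carrier(2,3))
      also have "\<dots> = residue_vec (monom 1 i) \<bullet> (residue_form *\<^sub>v (residue_mult *\<^sub>v residue_vec (monom 1 j)))"
        using that by (simp add: residue_vec_monom assoc_mult_mat_vec[of _ n n _ n])
      also have "\<dots> = residue_functional (monom 1 i * ([:0, 1:] * monom 1 j))"
        by (simp only: residue_mult_eq residue_form_eq)
      also have "monom 1 i * ([:0, 1:] * monom 1 j) = (monom 1 (Suc (i + j)) :: 'a poly)"
        by (simp add: mult_monom flip: monom_Suc)
      finally show ?thesis .
    qed
    have dims: "dim_row residue_form = n" "dim_col residue_mult = n"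
      by (auto simp: residue_form_def residue_mult_def)
    show ?thesis by (rule eq_matI) (simp_all add: entry dims add.commute del: index_mult_mat(1))
  qed
  moreover have "det residue_form \<noteq> 0"
  proof
    assume "det residue_form = 0"
    then obtain x where x: "x \<in> carrier_vec n" "x \<noteq> 0\<^sub>v n" "residue_form *\<^sub>v x = 0\<^sub>v n"
      using det_0_iff_vec_prod_zero_field[OF residue_carrier(3)] by auto
    obtain g where g: "x = residue_vec g" using residue_vec_surj[OF x(1)] .
    then have "\<not> f dvd r * g" using x(2) coprime residue_vec_eq_0_iff by blast
    then obtain h where h: "coeff ((r * g * h) mod f) (n - 1) \<noteq> 0" using coeff_top_nonzero by blast
    have "residue_functional (h * g) = 0"
      using residue_form_eq[of h g] x(3) by (simp flip: g)
    then show False using h by (simp add: residue_functional_def mult_ac)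
  qed
  moreover have "\<exists>c. x \<bullet> (residue_form *\<^sub>v x) = c\<^sup>2" if "x \<in> carrier_vec n" for x
  proof -
    obtain g where "x = residue_vec g" using residue_vec_surj[OF \<open>x \<in> carrier_vec n\<close>] .
    then show ?thesis
      using residue_form_eq[of g g] residue_form_square[OF two s, of g] by (auto simp: power2_eq_square)
  qed
  ultimately show "self_adjoint_pair n residue_mult residue_form"
    by (simp add: self_adjoint_pair_def)
  assume "\<not> f dvd s"
  then obtain g where "coeff ((s * g) mod f) (n - 1) \<noteq> 0" using coeff_top_nonzero by blast
  then have "residue_vec g \<bullet> (residue_form *\<^sub>v residue_vec g) \<noteq> 0"
    using residue_form_eq[of g g] residue_form_square[OF two s, of g] by (simp add: power2_eq_square)
  then show "\<not> alternating_form n residue_form"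
    unfolding alternating_form_def using residue_carrier(1) by blast
qed

end

section \<open>Orthogonal sums and the forms attached to irreducible factors\<close>

lemma char_poly_block_diag:
  fixes A1 A2 :: "'a :: field mat"
  assumes "A1 \<in> carrier_mat n1 n1" "A2 \<in> carrier_mat n2 n2"
  shows "char_poly (four_block_mat A1 (0\<^sub>m n1 n2) (0\<^sub>m n2 n1) A2) = char_poly A1 * char_poly A2"
proof -
  let ?C = "char_poly_matrix"
  have "?C (four_block_mat A1 (0\<^sub>m n1 n2) (0\<^sub>m n2 n1) A2) =
      four_block_mat (?C A1) (0\<^sub>m n1 n2) (0\<^sub>m n2 n1) (?C A2)"
    unfolding char_poly_matrix_def using assms by (intro eq_matI) (auto simp: one_poly_def)
  then show ?thesis
    using assms by (simp add: char_poly_def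
        det_four_block_mat_lower_left_zero[of "?C A1" n1 _ n2 _ "?C A2"])
qed

text \<open>Block diagonal matrices realize the orthogonal sum. A sum of two squares is again a
  square in characteristic two.\<close>

lemma self_adjoint_pair_sum:
  assumes two: "(2 :: 'a :: field) = 0"
    and 1: "self_adjoint_pair n1 A1 (B1 :: 'a mat)" and 2: "self_adjoint_pair n2 A2 B2"
  obtains A B where "self_adjoint_pair (n1 + n2) A B" "char_poly A = char_poly A1 * char_poly A2"
    "\<not> alternating_form n1 B1 \<Longrightarrow> \<not> alternating_form (n1 + n2) B"
proof
  define blk where "blk = (\<lambda>M1 M2 :: 'a mat. four_block_mat M1 (0\<^sub>m n1 n2) (0\<^sub>m n2 n1) M2)"
  note 1 = 1[unfolded self_adjoint_pair_def] and 2 = 2[unfolded self_adjoint_pair_def]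
  have carrier: "A1 \<in> carrier_mat n1 n1" "B1 \<in> carrier_mat n1 n1"
    "A2 \<in> carrier_mat n2 n2" "B2 \<in> carrier_mat n2 n2" using 1 2 by auto
  have blk_carrier: "blk M1 M2 \<in> carrier_mat (n1 + n2) (n1 + n2)"
    if "M1 \<in> carrier_mat n1 n1" "M2 \<in> carrier_mat n2 n2" for M1 M2
    using that by (simp add: blk_def)
  have blk_transpose: "transpose_mat (blk M1 M2) = blk (transpose_mat M1) (transpose_mat M2)"
    if "M1 \<in> carrier_mat n1 n1" "M2 \<in> carrier_mat n2 n2" for M1 M2
    using that by (simp add: blk_def transpose_four_block_mat[of _ n1 n1 _ n2 _ n2])
  have blk_mult: "blk M1 M2 * blk N1 N2 = blk (M1 * N1) (M2 * N2)"
    if "M1 \<in> carrier_mat n1 n1" "M2 \<in> carrier_mat n2 n2"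
      "N1 \<in> carrier_mat n1 n1" "N2 \<in> carrier_mat n2 n2" for M1 M2 N1 N2
    unfolding blk_def using that
    by (subst mult_four_block_mat[of _ n1 n1 _ n2 _ n2 _ _ n1 _ n2]) (auto intro!: cong_four_block_mat)
  have form: "(x1 @\<^sub>v x2) \<bullet> (blk B1 B2 *\<^sub>v (x1 @\<^sub>v x2)) = x1 \<bullet> (B1 *\<^sub>v x1) + x2 \<bullet> (B2 *\<^sub>v x2)"
    if x: "x1 \<in> carrier_vec n1" "x2 \<in> carrier_vec n2" for x1 x2
  proof -
    have "blk B1 B2 *\<^sub>v (x1 @\<^sub>v x2) = (B1 *\<^sub>v x1) @\<^sub>v (B2 *\<^sub>v x2)"
      unfolding blk_def by (rule mult_mat_vec_split[OF carrier(2,4) x])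
    then show ?thesis
      using scalar_prod_append[OF x, of "B1 *\<^sub>v x1" "B2 *\<^sub>v x2"] x carrier by simp
  qed
  have "\<exists>c. x \<bullet> (blk B1 B2 *\<^sub>v x) = c\<^sup>2" if "x \<in> carrier_vec (n1 + n2)" for x
  proof -
    define x1 x2 where "x1 = vec_first x n1" and "x2 = vec_last x n2"
    have x: "x = x1 @\<^sub>v x2" "x1 \<in> carrier_vec n1" "x2 \<in> carrier_vec n2"
      using that by (simp_all add: x1_def x2_def)
    obtain c1 c2 where "x1 \<bullet> (B1 *\<^sub>v x1) = c1\<^sup>2" "x2 \<bullet> (B2 *\<^sub>v x2) = c2\<^sup>2"
      using 1 2 x(2,3) by meson
    then have "x \<bullet> (blk B1 B2 *\<^sub>v x) = (c1 + c2)\<^sup>2"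
      unfolding x(1) form[OF x(2,3)] char_two_power2_add[OF two] by simp
    then show ?thesis by blast
  qed
  moreover have "det (blk B1 B2) \<noteq> 0"
    unfolding blk_def using carrier 1 2
    by (subst det_four_block_mat_lower_left_zero[of _ n1 _ n2]) auto
  moreover have "transpose_mat (blk B1 B2 * blk A1 A2) = blk B1 B2 * blk A1 A2"
    using carrier 1 2 blk_transpose[OF mult_carrier_mat[OF carrier(2,1)] mult_carrier_mat[OF carrier(4,3)]]
    by (simp add: blk_mult)
  ultimately show "self_adjoint_pair (n1 + n2) (blk A1 A2) (blk B1 B2)"
    using carrier 1 2 by (simp add: self_adjoint_pair_def blk_transpose blk_carrier)
  show "char_poly (blk A1 A2) = char_poly A1 * char_poly A2"
    unfolding blk_def by (rule char_poly_block_diag[OF carrier(1,3)])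
  assume "\<not> alternating_form n1 B1"
  then obtain x where x: "x \<in> carrier_vec n1" "x \<bullet> (B1 *\<^sub>v x) \<noteq> 0"
    by (auto simp: alternating_form_def)
  have "(0\<^sub>v n2) \<bullet> (B2 *\<^sub>v 0\<^sub>v n2) = 0"
    using carrier(4) by (intro scalar_prod_left_zero) auto
  then have "(x @\<^sub>v 0\<^sub>v n2) \<bullet> (blk B1 B2 *\<^sub>v (x @\<^sub>v 0\<^sub>v n2)) \<noteq> 0"
    using form[OF x(1), of "0\<^sub>v n2"] x(2) by simp
  moreover have "x @\<^sub>v 0\<^sub>v n2 \<in> carrier_vec (n1 + n2)" using x(1) by simp
  ultimately show "\<not> alternating_form (n1 + n2) (blk B1 B2)"
    unfolding alternating_form_def by blast
qed

lemma self_adjoint_pair_irreducible: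
  fixes p :: "'a :: field poly"
  assumes two: "(2 :: 'a) = 0" and p: "monic p" "irreducible p"
  obtains A B where "self_adjoint_pair (degree p) A B" "char_poly A = p"
    "pderiv p \<noteq> 0 \<Longrightarrow> \<not> alternating_form (degree p) B"
proof (cases "pderiv p = 0")
  case True
  have deg: "degree p \<ge> 1" using degree_irreducible_pos[OF p(2)] by simp
  \<comment> \<open>Inseparable case: \<open>r = 1\<close> and \<open>s = 0\<close>; the claim on
    alternation is vacuous.\<close>
  have "pderiv (1 * p) = 0\<^sup>2" using True by simp
  from residue_pair(1)[OF p(1) refl deg two this] char_poly_residue_mult[OF p(1) refl deg]
  show thesis using that True by auto
next
  case False
  have deg: "degree p \<ge> 1" using degree_irreducible_pos[OF p(2)] by simp
  have prime: "prime_elem p" using p(2) by (rule field_poly_irreducible_imp_prime)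
  \<comment> \<open>Serves twice: for cancelling \<open>r = pderiv p\<close> modulo
    \<open>p\<close>, and, since also \<open>s = pderiv p\<close>, for the form not being
    alternating.\<close>
  have ndvd: "\<not> p dvd pderiv p"
    using degree_pderiv_less[OF False] dvd_imp_degree_le[OF _ False] by (metis leD)
  \<comment> \<open>The derivative has only even powers of X, so a second derivative kills
    it.\<close>
  have "pderiv (pderiv p) = 0"
    unfolding poly_eq_iff coeff_pderiv_char_two[OF two] by simp
  then have s: "pderiv (pderiv p * p) = (pderiv p)\<^sup>2"
    by (simp add: pderiv_mult power2_eq_square)
  have coprime: "p dvd g" if "p dvd pderiv p * g" for g
    using that prime ndvd by (simp add: prime_elem_dvd_mult_iff)
  show thesis
    using that[OF residue_pair(1)[OF p(1) refl deg two s coprime] char_poly_residue_mult[OF p(1) refl deg]]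
      residue_pair(2)[OF p(1) refl deg two s coprime ndvd] by simp
qed

lemma self_adjoint_pair_inseparable_square:
  fixes p :: "'a :: field poly"
  assumes two: "(2 :: 'a) = 0" and p: "monic p" "irreducible p" "pderiv p = 0"
  obtains A B where "self_adjoint_pair (degree (p\<^sup>2)) A B" "char_poly A = p\<^sup>2"
    "\<not> alternating_form (degree (p\<^sup>2)) B"
proof -
  have "p \<noteq> 0" using p(1) by auto
  have degp: "degree p \<ge> 1" using degree_irreducible_pos[OF p(2)] by simp
  then have deg: "degree (p\<^sup>2) \<ge> 1" by (simp add: degree_power_eq \<open>p \<noteq> 0\<close>)
  have monic: "monic (p\<^sup>2)" using p(1) by (metis lead_coeff_power power_one)
  have prime: "prime_elem p" using p(2) by (rule field_poly_irreducible_imp_prime)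
  have s: "pderiv ([:0, 1:] * p\<^sup>2) = p\<^sup>2"
    unfolding pderiv_mult[of "[:0, 1:]"] pderiv_power2_char_two[OF two] by (simp add: pderiv_pCons)
  \<comment> \<open>A divisor of X of positive degree has degree 1; being monic it would have
    derivative 1, not 0.\<close>
  have X: "\<not> p dvd [:0, 1:]"
  proof
    assume "p dvd [:0, 1:]"
    then have "degree p = 1" using degp dvd_imp_degree_le[of p "[:0, 1:]"] by simp
    then have "coeff (pderiv p) 0 = 1"
      using p(1) by (simp add: coeff_pderiv)
    then show False using p(3) by simp
  qed
  have pX: "p dvd g" if "p dvd [:0, 1:] * g" for g
    using that prime X by (simp only: prime_elem_dvd_mult_iff) simp
  have coprime: "p\<^sup>2 dvd g" if "p\<^sup>2 dvd [:0, 1:] * g" for g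
  proof -
    have "p dvd [:0, 1:] * g" using that by (metis dvd_mult_left power2_eq_square)
    then obtain h where h: "g = p * h" using pX by blast
    then have "p * p dvd p * ([:0, 1:] * h)" using that by (simp only: power2_eq_square mult.left_commute)
    then have "p dvd [:0, 1:] * h" using \<open>p \<noteq> 0\<close> dvd_mult_cancel_left by blast
    then have "p dvd h" by (rule pX)
    then show ?thesis by (simp add: h power2_eq_square)
  qed
  \<comment> \<open>Here \<open>s = p\<close>, so this is the criterion for the form not being
    alternating.\<close>
  have "\<not> p\<^sup>2 dvd p"
    using dvd_imp_degree_le[of "p\<^sup>2" p] degp \<open>p \<noteq> 0\<close> by (auto simp: degree_power_eq)
  then show thesis
    using that[OF residue_pair(1)[OF monic refl deg two s coprime] char_poly_residue_mult[OF monic refl deg]]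
      residue_pair(2)[OF monic refl deg two s coprime] by blast
qed

text \<open>Orthogonal sum over the irreducible factors with multiplicity. Degree 0 is included,
  with empty matrices, so that the cofactor of a distinguished factor may be 1.\<close>

lemma self_adjoint_pair_exists:
  fixes f :: "'a :: field poly"
  assumes two: "(2 :: 'a) = 0" and "monic f"
  shows "\<exists>A B. self_adjoint_pair (degree f) A B \<and> char_poly A = f"
  using assms(2)
proof (induction "degree f" arbitrary: f rule: less_induct)
  case less
  show ?case
  proof (cases "degree f = 0")
    case True
    then have "f = 1" using less.prems by (metis degree_eq_zeroE lead_coeff_pCons(2) one_pCons)
    have "self_adjoint_pair 0 (1\<^sub>m 0) (1\<^sub>m 0 :: 'a mat)"
      by (auto simp: self_adjoint_pair_def scalar_prod_def intro: exI[of _ 0])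
    moreover have "char_poly (1\<^sub>m 0 :: 'a mat) = 1"
      using degree_monic_char_poly[of "1\<^sub>m 0 :: 'a mat" 0]
      by (metis degree_eq_zeroE lead_coeff_pCons(2) one_carrier_mat one_pCons)
    ultimately show ?thesis using \<open>f = 1\<close> by auto
  next
    case False
    then obtain p where p: "monic p" "irreducible p" "p dvd f"
      using monic_irreducible_factor_exists by blast
    then obtain g where g: "f = p * g" by blast
    have "monic g" using g p(1) less.prems by (metis lead_coeff_mult mult_1)
    have "g \<noteq> 0" "p \<noteq> 0" using \<open>monic g\<close> p(1) by auto
    then have deg: "degree f = degree p + degree g" by (simp add: g degree_mult_eq)
    then have "degree g < degree f" using degree_irreducible_pos[OF p(2)] by simp
    then obtain A2 B2 where 2: "self_adjoint_pair (degree g) A2 B2" "char_poly A2 = g"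
      using less.hyps \<open>monic g\<close> by blast
    obtain A1 B1 where 1: "self_adjoint_pair (degree p) A1 B1" "char_poly A1 = p"
      using self_adjoint_pair_irreducible[OF two p(1,2)] by metis
    show ?thesis
      using self_adjoint_pair_sum[OF two 1(1) 2(1)] 1(2) 2(2) g deg by metis
  qed
qed

text \<open>One summand that is not alternating suffices: whatever form is taken for
  \<open>h\<close>, the orthogonal sum then has an orthonormal basis.\<close>

lemma symmetric_mat_if_nonalternating_factor:
  fixes g h :: "'a :: field poly"
  assumes two: "(2 :: 'a) = 0" and "monic g" "monic h"
    and g: "self_adjoint_pair (degree g) A B" "char_poly A = g" "\<not> alternating_form (degree g) B"
  shows "\<exists>C\<in>carrier_mat (degree (g * h)) (degree (g * h)). symmetric_mat C \<and> char_poly C = g * h"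
proof -
  obtain A2 B2 where h: "self_adjoint_pair (degree h) A2 B2" "char_poly A2 = h"
    using self_adjoint_pair_exists[OF two \<open>monic h\<close>] by blast
  have "g \<noteq> 0" "h \<noteq> 0" using \<open>monic g\<close> \<open>monic h\<close> by auto
  then have deg: "degree (g * h) = degree g + degree h" by (simp add: degree_mult_eq)
  define n where "n = degree (g * h)"
  obtain A' B' where AB: "self_adjoint_pair n A' B'" "char_poly A' = g * h" "\<not> alternating_form n B'"
    using self_adjoint_pair_sum[OF two g(1) h(1)] g(2,3) h(2) deg n_def by metis
  note AB1 = AB(1)[unfolded self_adjoint_pair_def]
  obtain x where x: "x \<in> carrier_vec n" "x \<bullet> (B' *\<^sub>v x) \<noteq> 0"
    using AB(3) by (auto simp: alternating_form_def)
  obtain P where P: "P \<in> carrier_mat n n" "transpose_mat P * B' * P = 1\<^sub>m n"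
    using Gram_factorization[of B' n x] AB1 two x by blast
  then have "\<exists>C\<in>carrier_mat n n. symmetric_mat C \<and> char_poly C = char_poly A'"
    using AB1 by (intro symmetric_similar_if_self_adjoint[of A' n B' P]) auto
  then show ?thesis using AB(2) by (simp add: n_def)
qed

section \<open>The characterization and the case of perfect fields\<close>

lemma exists_symmetric_mat_iff:
  fixes f :: "'a :: field poly"
  assumes two: "(2 :: 'a) = 0" and f: "monic f" "degree f \<ge> 1"
  shows "(\<exists>A\<in>carrier_mat (degree f) (degree f). symmetric_mat A \<and> char_poly A = f) \<longleftrightarrow>
    \<not> (\<exists>P. finite P \<and> (\<forall>p\<in>P. monic p \<and> irreducible p \<and> inseparable_poly p) \<and> f = \<Prod>P)"
proof (rule iffI notI)+
  assume "\<exists>A\<in>carrier_mat (degree f) (degree f). symmetric_mat A \<and> char_poly A = f"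
    and "\<exists>P. finite P \<and> (\<forall>p\<in>P. monic p \<and> irreducible p \<and> inseparable_poly p) \<and> f = \<Prod>P"
  then obtain A P where A: "A \<in> carrier_mat (degree f) (degree f)" "transpose_mat A = A" "char_poly A = f"
    and P: "finite P" "\<forall>p\<in>P. monic p \<and> irreducible p \<and> inseparable_poly p" "f = \<Prod>P"
    by (auto simp: symmetric_mat_def)
  \<comment> \<open>By Leibniz each summand contains the derivative of an inseparable factor, which
    is zero.\<close>
  have "pderiv f = (\<Sum>p\<in>P. \<Prod>(P - {p}) * pderiv p)"
    unfolding P(3) by (rule pderiv_prod)
  also have "\<dots> = 0"
    using P(2) inseparable_iff_pderiv_eq_0 by (intro sum.neutral) auto
  finally have "pderiv (char_poly A) = 0" using A(3) by simp
  then obtain q where "degree q > 0" "q\<^sup>2 dvd char_poly A"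
    using square_dvd_even_char_poly[OF A(1,2) two f(2)] by blast
  then show False using irreducible_squarefree_prod[OF P(1), of q] P(2,3) A(3) by auto
next
  assume not_prod: "\<not> (\<exists>P. finite P \<and> (\<forall>p\<in>P. monic p \<and> irreducible p \<and> inseparable_poly p) \<and> f = \<Prod>P)"
  have monic_cofactor: "monic h" if "f = g * h" "monic g" for g h
    using that f(1) by (metis lead_coeff_mult mult_1)
  \<comment> \<open>If no irreducible divisor is separable, then any irreducible polynomial whose
    square divides \<open>f\<close> has derivative zero. So outside the first two cases
    \<open>f\<close> is squarefree with inseparable factors only.\<close>
  consider (sep) p where "monic p" "irreducible p" "p dvd f" "pderiv p \<noteq> 0"
    | (square) p where "monic p" "irreducible p" "p\<^sup>2 dvd f" "pderiv p = 0"
    | (prod) "\<forall>p. monic p \<longrightarrow> irreducible p \<longrightarrow> p dvd f \<longrightarrow> pderiv p = 0"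
      "\<forall>p. monic p \<longrightarrow> irreducible p \<longrightarrow> \<not> p\<^sup>2 dvd f"
    by (metis dvd_mult_left power2_eq_square)
  then show "\<exists>A\<in>carrier_mat (degree f) (degree f). symmetric_mat A \<and> char_poly A = f"
  proof cases
    case sep
    obtain h where h: "f = p * h" using sep(3) by blast
    obtain A B where "self_adjoint_pair (degree p) A B" "char_poly A = p" "\<not> alternating_form (degree p) B"
      using self_adjoint_pair_irreducible[OF two sep(1,2)] sep(4) by metis
    from symmetric_mat_if_nonalternating_factor[OF two sep(1) monic_cofactor[OF h sep(1)] this]
    show ?thesis by (simp add: h)
  next
    case square
    obtain h where h: "f = p\<^sup>2 * h" using square(3) by blast
    have monic: "monic (p\<^sup>2)" using square(1) by (metis lead_coeff_power power_one)
    obtain A B where "self_adjoint_pair (degree (p\<^sup>2)) A B" "char_poly A = p\<^sup>2"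
      "\<not> alternating_form (degree (p\<^sup>2)) B"
      using self_adjoint_pair_inseparable_square[OF two square(1,2,4)] by metis
    from symmetric_mat_if_nonalternating_factor[OF two monic monic_cofactor[OF h monic] this]
    show ?thesis by (simp add: h)
  next
    case prod
    obtain P where P: "finite P" "\<And>p. p \<in> P \<Longrightarrow> monic p \<and> irreducible p \<and> p dvd f" "f = \<Prod>P"
      using squarefree_eq_prod_irreducible[OF f(1)] prod(2) by metis
    then have "\<forall>p\<in>P. monic p \<and> irreducible p \<and> inseparable_poly p"
      using prod(1) inseparable_iff_pderiv_eq_0 by blast
    then have False using not_prod P(1,3) by blast
    then show ?thesis ..
  qed
qed

text \<open>An inseparable irreducible polynomial is a polynomial in the square of X, hence itself a
  square when every coefficient has a square root.\<close>

lemma perfect_field_not_inseparable: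
  fixes p :: "'a :: field poly"
  assumes two: "(2 :: 'a) = 0" and surj: "surj (\<lambda>x :: 'a. x\<^sup>2)" and p: "irreducible p"
  shows "\<not> inseparable_poly p"
proof
  assume "inseparable_poly p"
  then have "pderiv p = 0" using inseparable_iff_pderiv_eq_0[OF p] by blast
  then obtain h where "p = even_poly h" using pderiv_eq_0_imp_even_poly[OF two] by blast
  then obtain g where g: "p = g * g"
    using even_poly_eq_square[OF two surj, of h] by (metis power2_eq_square)
  then have "g dvd 1" using p unfolding irreducible_def by blast
  then have "p dvd 1" using g by (metis mult_dvd_mono mult_1)
  then show False using p by (simp add: irreducible_def)
qed

theorem corollary1p2:
  fixes f :: "'a :: field poly" and n :: nat
  assumes "CHAR('a) = 2"
    and "lead_coeff f = 1" and "degree f = n" and "n \<ge> 1"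
  shows "((\<exists>A \<in> carrier_mat n n. symmetric_mat A \<and> char_poly A = f) \<longleftrightarrow>
          \<not> (\<exists>P. finite P \<and>
                 (\<forall>p \<in> P. lead_coeff p = 1 \<and> irreducible p \<and> inseparable_poly p) \<and>
                 f = \<Prod>P)) \<and>
         (perfect_field TYPE('a) \<longrightarrow>
           (\<exists>A \<in> carrier_mat n n. symmetric_mat A \<and> char_poly A = f))"
proof (intro conjI impI)
  have two: "(2 :: 'a) = 0" using assms(1) by (rule char_two)
  show iff: "(\<exists>A\<in>carrier_mat n n. symmetric_mat A \<and> char_poly A = f) \<longleftrightarrow>
      \<not> (\<exists>P. finite P \<and> (\<forall>p\<in>P. lead_coeff p = 1 \<and> irreducible p \<and> inseparable_poly p) \<and> f = \<Prod>P)"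
    using exists_symmetric_mat_iff[OF two assms(2)] assms(3,4) by simp
  assume "perfect_field TYPE('a)"
  then have surj: "surj (\<lambda>x :: 'a. x\<^sup>2)" using assms(1) by (simp add: perfect_field_def)
  have False if P: "\<forall>p\<in>P. lead_coeff p = 1 \<and> irreducible p \<and> inseparable_poly p" "f = \<Prod>P" for P
  proof -
    \<comment> \<open>Only the empty product remains, and it has degree 0.\<close>
    have "P = {}" using P(1) perfect_field_not_inseparable[OF two surj] by blast
    then have "degree f = 0" using P(2) by simp
    then show False using assms(3,4) by simp
  qed
  then show "\<exists>A\<in>carrier_mat n n. symmetric_mat A \<and> char_poly A = f" unfolding iff by blast
qed

end
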